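(* Let $n\geq 1$, let $\mu$ be a real number with $2\mu\geq n-2$, and let $A:\mathbb{R}^n\to\mathbb{C}^{n\times n}$ be bounded measurable, satisfying for some constants $\lambda,\Lambda>0$ $$\mathrm{Re}\big(A_{kl}(x)p_k\overline{p}_l\big)\geq\lambda|p|^2,\qquad |A(x)p|^2\leq\Lambda^2|p|^2\qquad\text{for all }x\in\mathbb{R}^n,\ p\in\mathbb{C}^n.$$ Suppose $w\in H^1_{loc}(\mathbb{R}^n;\mathbb{C})$ solves, in the sense of distributions, $$\mathrm{div}(A(x)\nabla w) = \tfrac12\big(iw+\mu w + x\cdot\nabla w\big)\quad\text{on }\mathbb{R}^n,$$ satisfies $|w(x)| = O(|x|^{-\mu})$ as $|x|\to\infty$, and in addition satisfies the monotonicity condition $$(2\mu + x\cdot\nabla)|w|^2 \geq 0 \quad\text{on }\mathbb{R}^n.$$ Then $w\equiv 0$.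
   Context: Summation over repeated indices $k,l$ is used. *)

theory Defs
  imports "HOL-Analysis.Analysis"
begin

definition pd :: "'n::finite \<Rightarrow> (real^'n \<Rightarrow> 'b::real_normed_vector) \<Rightarrow> real^'n \<Rightarrow> 'b" where
  "pd i f x = vector_derivative (\<lambda>t. f (x + t *\<^sub>R axis i 1)) (at 0)"

coinductive smooth :: "(real^'n::finite \<Rightarrow> 'b::real_normed_vector) \<Rightarrow> bool" where
  "continuous_on UNIV f \<Longrightarrow>
   (\<And>i x. (\<lambda>t. f (x + t *\<^sub>R axis i 1)) differentiable (at 0)) \<Longrightarrow>
   (\<And>i. smooth (pd i f)) \<Longrightarrow> smooth f"

definition test_fun :: "(real^'n::finite \<Rightarrow> 'b::real_normed_vector) \<Rightarrow> bool" where
  "test_fun \<phi> \<longleftrightarrow> smooth \<phi> \<and> compact (closure {x. \<phi> x \<noteq> 0})"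

definition loc_L2 :: "(real^'n::finite \<Rightarrow> 'b::{banach,second_countable_topology}) \<Rightarrow> bool" where
  "loc_L2 f \<longleftrightarrow> f \<in> borel_measurable lebesgue \<and>
     (\<forall>K. compact K \<longrightarrow> set_integrable lebesgue K (\<lambda>x. (norm (f x))\<^sup>2))"

definition weak_gradient :: "(real^'n::finite \<Rightarrow> complex) \<Rightarrow> (real^'n \<Rightarrow> complex^'n) \<Rightarrow> bool" where
  "weak_gradient w g \<longleftrightarrow> (\<forall>k. \<forall>\<phi>::real^'n \<Rightarrow> complex. test_fun \<phi> \<longrightarrow>
     integral\<^sup>L lebesgue (\<lambda>x. w x * pd k \<phi> x) = - integral\<^sup>L lebesgue (\<lambda>x. g x $ k * \<phi> x))"

definition H1_loc :: "(real^'n::finite \<Rightarrow> complex) \<Rightarrow> (real^'n \<Rightarrow> complex^'n) \<Rightarrow> bool" where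
  "H1_loc w g \<longleftrightarrow> loc_L2 w \<and> loc_L2 g \<and> weak_gradient w g"

end

theory Submission
  imports Defs
begin

text \<open>
  Testing the equation with the conjugate of \<open>w\<close> times a cutoff \<open>\<eta>\<^sup>2\<close> and taking real parts, the lower order
  terms combine to a nonpositive multiple of the quantity in the monotonicity condition, so they can be
  dropped. Ellipticity then gives a Caccioppoli inequality: for every \<open>t > 0\<close>, the energy of the gradient weighted by
  \<open>\<eta>\<^sup>2\<close> is at most \<open>(Lam / lam) (t Q + W / t)\<close>, where \<open>Q\<close> is the energy on the annulus
  \<open>R \<le> |x| \<le> 2R\<close> and \<open>W\<close> the integral of \<open>|w|\<^sup>2 |\<nabla>\<eta>|\<^sup>2\<close>. The decay of \<open>w\<close> and \<open>2\<mu> \<ge> n - 2\<close> bound \<open>W\<close> uniformly in \<open>R\<close>.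
  Hence the total energy is finite, so the annulus term tends to zero; letting \<open>R\<close> and then \<open>t\<close> tend to
  infinity shows that the gradient vanishes. The equation reduces to \<open>(i + \<mu>) w = 0\<close>.
\<close>

section \<open>Smooth functions and test functions\<close>

text \<open>The conjugate of w times \<eta>^2 is only Sobolev, not a test function. Most of what
  precedes the energy inequality serves \<open>weak_form_test_sobolev\<close>, which admits such
  functions. It is used three times: on the equation, on the definition of the weak gradient (giving
  the product rule for |w|^2), and with zero flux (turning vanishing against all test functions into
  w = 0). The case 2\<mu> = n - 2 is borderline: the mass of |w|^2 on the annulus may grow like R^2,
  which only cancels the factor R^-2 from |\<nabla>\<eta>|^2, so W is bounded but need not tend to
  zero. This is why t stays free and the Caccioppoli inequality is used twice: a small fixed t
  absorbs the annulus term and bounds the energy, and then arbitrary t is combined with the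
  vanishing of the annulus energy. The term iw contributes nothing to the real part and returns only
  at the end, where it keeps i + \<mu> away from zero even for \<mu> = 0.\<close>

lemma smooth_continuous: "smooth f \<Longrightarrow> continuous_on UNIV f"
  by (erule smooth.cases) auto

lemma smooth_pd: "smooth f \<Longrightarrow> smooth (pd i f)"
  by (erule smooth.cases) auto

lemma smooth_has_pd:
  "smooth f \<Longrightarrow> ((\<lambda>t. f (x + t *\<^sub>R axis i 1)) has_vector_derivative pd i f x) (at 0)"
  unfolding pd_def by (erule smooth.cases) (auto simp: vector_derivative_works)

lemma pd_eqI:
  "((\<lambda>t. f (x + t *\<^sub>R axis i 1)) has_vector_derivative d) (at 0) \<Longrightarrow> pd i f x = d"
  unfolding pd_def by (rule vector_derivative_at)

lemma smooth_const [simp]: "smooth (\<lambda>x. c)"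
proof -
  have "smooth f" if "\<exists>c. f = (\<lambda>x. c)" for f :: "real^'a \<Rightarrow> 'b"
    using that by (coinduction arbitrary: f) (force simp: pd_def)
  then show ?thesis by blast
qed

lemma smooth_component [simp]: "smooth (\<lambda>x. x $ k)"
proof (rule smooth.intros)
  have d: "((\<lambda>t. (x + t *\<^sub>R axis i 1) $ k) has_vector_derivative (axis i 1 $ k :: real)) (at 0)"
    for x :: "real^'a" and i
    by (auto intro!: derivative_eq_intros simp: has_vector_derivative_def)
  show "(\<lambda>t. (x + t *\<^sub>R axis i 1) $ k) differentiable at (0::real)" for x :: "real^'a" and i
    using d by (rule differentiableI_vector)
  have "pd i (\<lambda>x. x $ k) = (\<lambda>_. axis i 1 $ k :: real)" for i
    using pd_eqI[OF d] by blast
  then show "smooth (pd i (\<lambda>x. x $ k))" for i by simp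
qed (intro continuous_intros)

lemma pd_component: "pd i (\<lambda>x. x $ k) x = (if i = k then 1 else 0 :: real)"
  by (rule pd_eqI)
    (auto intro!: derivative_eq_intros simp: has_vector_derivative_def axis_def)

text \<open>The classical flat function exp(-1/t), extended by zero. The poles t^-m are built in
  because differentiation creates them: the span of the whole family is closed under derivatives,
  while the single function m = 0 is not.\<close>

definition exp_bump :: "nat \<Rightarrow> real \<Rightarrow> real" where
  "exp_bump m t = (if t > 0 then exp (- 1 / t) / t ^ m else 0)"

lemma exp_bump_nonneg: "exp_bump m t \<ge> 0"
  by (simp add: exp_bump_def)

lemma exp_bump_pos_iff: "exp_bump m t > 0 \<longleftrightarrow> t > 0"
  by (simp add: exp_bump_def)

lemma exp_bump_0_mono: "s \<le> t \<Longrightarrow> exp_bump 0 s \<le> exp_bump 0 t"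
  by (auto simp: exp_bump_def frac_le)

lemma tendsto_exp_bump_0: "(exp_bump m \<longlongrightarrow> 0) (at 0)"
proof -
  have "((\<lambda>x. inverse x ^ m / exp (inverse x)) \<longlongrightarrow> (0::real)) (at_right 0)"
    by (rule filterlim_compose[OF tendsto_power_div_exp_0 filterlim_inverse_at_top_right])
  then have "(exp_bump m \<longlongrightarrow> 0) (at_right 0)"
    by (rule Lim_transform_eventually)
      (auto simp: eventually_at_right_field exp_bump_def exp_minus field_simps intro!: exI[of _ 1])
  moreover have "(exp_bump m \<longlongrightarrow> 0) (at_left 0)"
    by (rule Lim_transform_eventually[OF tendsto_const])
      (auto simp: eventually_at_left_field exp_bump_def intro!: exI[of _ "-1"])
  ultimately show ?thesis
    by (simp add: filterlim_split_at)
qed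

lemma DERIV_exp_bump:
  "(exp_bump m has_real_derivative (exp_bump (m + 2) t - m * exp_bump (m + 1) t)) (at t)"
proof -
  consider "t > 0" | "t < 0" | "t = 0" by linarith
  then show ?thesis
  proof cases
    case 1
    have "((\<lambda>t. exp (- 1 / t)) has_real_derivative exp (- 1 / t) * (1 / t\<^sup>2)) (at t)"
      using 1 by (auto intro!: derivative_eq_intros simp: power2_eq_square)
    then have "((\<lambda>t. exp (- 1 / t) / t ^ m) has_real_derivative
        (exp (- 1 / t) * (1 / t\<^sup>2) * t ^ m - exp (- 1 / t) * (real m * t ^ (m - Suc 0))) / (t ^ m * t ^ m)) (at t)"
      using 1 by (intro DERIV_divide DERIV_pow) auto
    moreover have "(exp (- 1 / t) * (1 / t\<^sup>2) * t ^ m - exp (- 1 / t) * (real m * t ^ (m - Suc 0))) / (t ^ m * t ^ m)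
        = exp_bump (m + 2) t - m * exp_bump (m + 1) t"
      using 1 by (cases m) (simp_all add: exp_bump_def field_simps power2_eq_square)
    ultimately have "((\<lambda>t. exp (- 1 / t) / t ^ m) has_real_derivative
        (exp_bump (m + 2) t - m * exp_bump (m + 1) t)) (at t)" by simp
    then show ?thesis
      by (rule DERIV_cong_ev[THEN iffD1, rotated 3])
        (auto simp: exp_bump_def intro!: eventually_mono[OF eventually_nhds_in_open[of "{0<..}"]] 1)
  next
    case 2
    have "((\<lambda>t. 0) has_real_derivative 0) (at t)" by simp
    then have "(exp_bump m has_real_derivative 0) (at t)"
      by (rule DERIV_cong_ev[THEN iffD1, rotated 3])
        (auto simp: exp_bump_def intro!: eventually_mono[OF eventually_nhds_in_open[of "{..<0}"]] 2)
    then show ?thesis using 2 by (simp add: exp_bump_def)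
  next
    case 3
    \<comment> \<open>At the origin the difference quotient is itself a member of the family,
      \<open>exp_bump (Suc m) h\<close>, so flatness of every member gives derivative zero.\<close>
    have "((\<lambda>h. (exp_bump m h - exp_bump m 0) / h) \<longlongrightarrow> 0) (at 0)"
      by (rule Lim_transform_eventually[OF tendsto_exp_bump_0[of "Suc m"]])
        (auto simp: exp_bump_def eventually_at_filter)
    then show ?thesis using 3 by (simp add: DERIV_def) (simp add: exp_bump_def)
  qed
qed

text \<open>Smoothness is coinductive, so products and compositions are handled by showing that the
  algebra they generate is closed under partial derivatives.\<close>

inductive smooth_alg :: "(real^'n::finite \<Rightarrow> real) \<Rightarrow> bool" where
  base: "smooth f \<Longrightarrow> smooth_alg f"
| add: "smooth_alg f \<Longrightarrow> smooth_alg g \<Longrightarrow> smooth_alg (\<lambda>x. f x + g x)"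
| mult: "smooth_alg f \<Longrightarrow> smooth_alg g \<Longrightarrow> smooth_alg (\<lambda>x. f x * g x)"
| bump: "smooth f \<Longrightarrow> smooth_alg (\<lambda>x. exp_bump m (f x))"

text \<open>The invariant behind the coinduction in \<open>smooth_alg_smooth\<close>: members are
  continuous and have partial derivatives that are members again. The \<open>bump\<close> case stays
  inside because \<open>DERIV_exp_bump\<close> only raises the index.\<close>

lemma smooth_alg_step:
  assumes "smooth_alg f"
  shows "continuous_on UNIV f \<and> (\<exists>f'. \<forall>i. smooth_alg (f' i) \<and>
    (\<forall>x. ((\<lambda>t. f (x + t *\<^sub>R axis i 1)) has_vector_derivative f' i x) (at 0)))"
  using assms
proof induction
  case (base f)
  then show ?case
    by (intro conjI exI[of _ "\<lambda>i. pd i f"])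
      (auto intro: smooth_continuous smooth_has_pd smooth_pd smooth_alg.base)
next
  case (add f g)
  then obtain f' g' where *: "\<forall>i. smooth_alg (f' i) \<and>
    (\<forall>x. ((\<lambda>t. f (x + t *\<^sub>R axis i 1)) has_vector_derivative f' i x) (at 0))"
    "\<forall>i. smooth_alg (g' i) \<and>
    (\<forall>x. ((\<lambda>t. g (x + t *\<^sub>R axis i 1)) has_vector_derivative g' i x) (at 0))" by blast
  show ?case
    using * add.IH
    by (intro conjI exI[of _ "\<lambda>i x. f' i x + g' i x"])
      (auto intro!: continuous_intros smooth_alg.add has_vector_derivative_add)
next
  case (mult f g)
  then obtain f' g' where *: "\<forall>i. smooth_alg (f' i) \<and>
    (\<forall>x. ((\<lambda>t. f (x + t *\<^sub>R axis i 1)) has_vector_derivative f' i x) (at 0))"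
    "\<forall>i. smooth_alg (g' i) \<and>
    (\<forall>x. ((\<lambda>t. g (x + t *\<^sub>R axis i 1)) has_vector_derivative g' i x) (at 0))" by blast
  have "((\<lambda>t. f (x + t *\<^sub>R axis i 1) * g (x + t *\<^sub>R axis i 1)) has_vector_derivative
      f x * g' i x + f' i x * g x) (at 0)" for i x
    using has_vector_derivative_mult[of "\<lambda>t. f (x + t *\<^sub>R axis i 1)" "f' i x" 0 UNIV
        "\<lambda>t. g (x + t *\<^sub>R axis i 1)" "g' i x"] * by simp
  then show ?case
    using * mult
    by (intro conjI exI[of _ "\<lambda>i x. f x * g' i x + f' i x * g x"])
      (auto intro!: continuous_intros smooth_alg.intros(2,3))
next
  case (bump f m)
  let ?b = "\<lambda>m x. exp_bump m (f x)"
  have d: "((\<lambda>t. ?b m (x + t *\<^sub>R axis i 1)) has_vector_derivative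
      (?b (m + 2) x + - real m * ?b (m + 1) x) * pd i f x) (at 0)" for i x
    using DERIV_chain2[OF DERIV_exp_bump
        smooth_has_pd[OF bump, folded has_real_derivative_iff_has_vector_derivative], of m x i]
    by (simp add: has_real_derivative_iff_has_vector_derivative)
  have "isCont (exp_bump m) t" for t
    using DERIV_exp_bump by (rule DERIV_isCont)
  then have "continuous_on UNIV (exp_bump m)"
    by (simp add: continuous_at_imp_continuous_on)
  then have "continuous_on UNIV (?b m)"
    using smooth_continuous[OF bump] by (rule continuous_on_compose2) auto
  moreover have "smooth_alg (\<lambda>x. (?b (m + 2) x + - real m * ?b (m + 1) x) * pd i f x)" for i
    by (intro smooth_alg.mult smooth_alg.add smooth_alg.bump[OF bump] smooth_alg.base
        smooth_pd[OF bump] smooth_const)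
  ultimately show ?case
    using d by (intro conjI exI[of _ "\<lambda>i x. (?b (m + 2) x + - real m * ?b (m + 1) x) * pd i f x"]) auto
qed

lemma smooth_alg_smooth: "smooth_alg f \<Longrightarrow> smooth f"
proof (coinduction arbitrary: f)
  case smooth
  then obtain f' where f': "continuous_on UNIV f" "\<And>i. smooth_alg (f' i)"
    "\<And>i x. ((\<lambda>t. f (x + t *\<^sub>R axis i 1)) has_vector_derivative f' i x) (at 0)"
    using smooth_alg_step by blast
  then have "pd i f = f' i" for i using pd_eqI by blast
  with f' show ?case
    by (auto intro: differentiableI_vector)
qed

section \<open>Closure properties of smooth functions and rules for partial derivatives\<close>

lemma smooth_add: "smooth f \<Longrightarrow> smooth g \<Longrightarrow> smooth (\<lambda>x. f x + g x)" for f :: "_ \<Rightarrow> real"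
  by (rule smooth_alg_smooth[OF smooth_alg.add[OF smooth_alg.base smooth_alg.base]])

lemma smooth_mult: "smooth f \<Longrightarrow> smooth g \<Longrightarrow> smooth (\<lambda>x. f x * g x)" for f :: "_ \<Rightarrow> real"
  by (rule smooth_alg_smooth[OF smooth_alg.mult[OF smooth_alg.base smooth_alg.base]])

lemma smooth_exp_bump: "smooth f \<Longrightarrow> smooth (\<lambda>x. exp_bump m (f x))"
  by (rule smooth_alg_smooth[OF smooth_alg.bump])

lemma smooth_diff: "smooth f \<Longrightarrow> smooth g \<Longrightarrow> smooth (\<lambda>x. f x - g x)" for f :: "_ \<Rightarrow> real"
  using smooth_add[of f "\<lambda>x. -1 * g x"] smooth_mult[of "\<lambda>_. -1" g] by simp

lemma smooth_sum: "(\<And>k. k \<in> I \<Longrightarrow> smooth (f k)) \<Longrightarrow> smooth (\<lambda>x. \<Sum>k\<in>I. f k x)"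
  for f :: "_ \<Rightarrow> _ \<Rightarrow> real"
  by (induction I rule: infinite_finite_induct) (simp_all add: smooth_add)

lemma smooth_norm_power2: "smooth (\<lambda>x. (norm x)\<^sup>2)"
proof -
  have "(\<lambda>x::real^'a. (norm x)\<^sup>2) = (\<lambda>x. \<Sum>k\<in>UNIV. x $ k * x $ k)"
    by (simp add: power2_norm_eq_inner inner_vec_def)
  then show ?thesis by (simp add: smooth_sum smooth_mult)
qed

lemma pd_mult:
  fixes f g :: "real^'n \<Rightarrow> real"
  assumes "smooth f" "smooth g"
  shows "pd i (\<lambda>x. f x * g x) x = f x * pd i g x + pd i f x * g x"
  using has_vector_derivative_mult[OF smooth_has_pd[OF assms(1)] smooth_has_pd[OF assms(2)], of x i]
  by (intro pd_eqI) simp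

lemma has_pd_affine:
  assumes "smooth f"
  shows "((\<lambda>t. f (c + s *\<^sub>R (x + t *\<^sub>R axis i 1))) has_vector_derivative
    s *\<^sub>R pd i f (c + s *\<^sub>R x)) (at 0)"
proof -
  have "((\<lambda>t. f ((c + s *\<^sub>R x) + t *\<^sub>R axis i 1)) \<circ> (\<lambda>t. s * t) has_vector_derivative
      s *\<^sub>R pd i f (c + s *\<^sub>R x)) (at 0)"
    using smooth_has_pd[OF assms, of "c + s *\<^sub>R x" i]
    by (intro vector_diff_chain_at)
      (auto intro!: derivative_eq_intros simp flip: has_real_derivative_iff_has_vector_derivative)
  then show ?thesis
    by (simp add: o_def algebra_simps)
qed

lemma pd_affine:
  "smooth f \<Longrightarrow> pd i (\<lambda>x. f (c + s *\<^sub>R x)) x = s *\<^sub>R pd i f (c + s *\<^sub>R x)"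
  by (intro pd_eqI has_pd_affine)

lemma smooth_affine:
  fixes f :: "real^'n \<Rightarrow> real"
  assumes "smooth f"
  shows "smooth (\<lambda>x. f (c + s *\<^sub>R x))"
proof -
  \<comment> \<open>Each derivative of an affine composition produces a factor \<open>s\<close>. The
    coinduction invariant therefore carries an arbitrary scalar \<open>r\<close>.\<close>
  have "smooth h" if "\<exists>r f. smooth f \<and> h = (\<lambda>x. r *\<^sub>R f (c + s *\<^sub>R x))" for h :: "real^'n \<Rightarrow> real"
    using that
  proof (coinduction arbitrary: h)
    case smooth
    then obtain r f where f: "smooth f" and h: "h = (\<lambda>x. r *\<^sub>R f (c + s *\<^sub>R x))" by blast
    have d: "((\<lambda>t. h (x + t *\<^sub>R axis i 1)) has_vector_derivative
        (r * s) *\<^sub>R pd i f (c + s *\<^sub>R x)) (at 0)" for i x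
      using bounded_linear.has_vector_derivative[OF bounded_linear_scaleR_right[of r] has_pd_affine[OF f]]
      unfolding h by (simp add: mult.assoc)
    have p: "pd i h = (\<lambda>x. (r * s) *\<^sub>R pd i f (c + s *\<^sub>R x))" for i
      using pd_eqI[OF d] by blast
    have "continuous_on UNIV h" unfolding h
      by (intro continuous_intros continuous_on_compose2[OF smooth_continuous[OF f]]) auto
    moreover have "(\<lambda>t. h (x + t *\<^sub>R axis i 1)) differentiable at 0" for i x
      using d by (rule differentiableI_vector)
    moreover have "\<exists>r g. smooth g \<and> pd i h = (\<lambda>x. r *\<^sub>R g (c + s *\<^sub>R x))" for i
      using p smooth_pd[OF f] by blast
    ultimately show ?case
      by (intro exI[of _ h]) simp
  qed
  moreover have "\<exists>r g. smooth g \<and> (\<lambda>x. f (c + s *\<^sub>R x)) = (\<lambda>x. r *\<^sub>R g (c + s *\<^sub>R x))"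
    by (rule exI[of _ 1], rule exI[of _ f]) (simp add: assms)
  ultimately show ?thesis by blast
qed

lemma has_pd_of_real:
  assumes "smooth f"
  shows "((\<lambda>t. complex_of_real (f (x + t *\<^sub>R axis i 1))) has_vector_derivative
    complex_of_real (pd i f x)) (at 0)"
  using bounded_linear.has_vector_derivative[OF bounded_linear_of_real smooth_has_pd[OF assms]] .

lemma pd_of_real: "smooth f \<Longrightarrow> pd i (\<lambda>x. complex_of_real (f x)) x = complex_of_real (pd i f x)"
  by (intro pd_eqI has_pd_of_real)

lemma smooth_of_real: "smooth f \<Longrightarrow> smooth (\<lambda>x. complex_of_real (f x))"
proof (coinduction arbitrary: f)
  case smooth
  then have "pd i (\<lambda>x. complex_of_real (f x)) = (\<lambda>x. complex_of_real (pd i f x))" for i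
    using pd_of_real by blast
  moreover have "continuous_on UNIV (\<lambda>x. complex_of_real (f x))"
    using smooth by (intro continuous_intros smooth_continuous)
  ultimately show ?case
    using differentiableI_vector[OF has_pd_of_real[OF smooth]] smooth_pd[OF smooth] by blast
qed

section \<open>Test functions, their supports and their bounds\<close>

lemma test_funI:
  assumes "smooth \<phi>" "\<And>x. norm x > R \<Longrightarrow> \<phi> x = 0"
  shows "test_fun \<phi>"
proof -
  have "{x. \<phi> x \<noteq> 0} \<subseteq> cball 0 R"
    using assms(2) by (auto simp: not_less[symmetric])
  then have "bounded {x. \<phi> x \<noteq> 0}"
    using bounded_cball bounded_subset by blast
  with assms(1) show ?thesis
    by (simp add: test_fun_def compact_closure)
qed

lemma test_funE:
  assumes "test_fun \<phi>"
  obtains R where "R > 0" "\<And>x. norm x > R \<Longrightarrow> \<phi> x = 0"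
proof -
  have "bounded {x. \<phi> x \<noteq> 0}"
    using assms compact_imp_bounded bounded_subset closure_subset unfolding test_fun_def by metis
  then obtain R where "R > 0" "\<And>x. \<phi> x \<noteq> 0 \<Longrightarrow> norm x \<le> R"
    by (auto simp: bounded_pos)
  then show ?thesis using that by force
qed

lemma test_fun_smooth: "test_fun \<phi> \<Longrightarrow> smooth \<phi>"
  by (simp add: test_fun_def)

lemma pd_eq_0_open:
  assumes "open S" "x \<in> S" "\<And>y. y \<in> S \<Longrightarrow> f y = c"
  shows "pd i f x = 0"
proof (rule pd_eqI)
  have "((\<lambda>t. x + t *\<^sub>R axis i 1) \<longlongrightarrow> x + 0 *\<^sub>R axis i 1) (nhds 0)"
    by (intro tendsto_intros) (simp add: filterlim_ident)
  then have "eventually (\<lambda>t. x + t *\<^sub>R axis i 1 \<in> S) (nhds 0)"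
    using assms(1,2) by (simp add: tendsto_def)
  then have "eventually (\<lambda>t. f (x + t *\<^sub>R axis i 1) = c) (nhds 0)"
    by (rule eventually_mono) (use assms(3) in blast)
  then show "((\<lambda>t. f (x + t *\<^sub>R axis i 1)) has_vector_derivative 0) (at 0)"
    using has_vector_derivative_cong_ev[of UNIV "\<lambda>t. f (x + t *\<^sub>R axis i 1)" "\<lambda>_. c" 0 0] assms(2,3)
    by simp
qed

lemma pd_eq_0_outside:
  assumes "\<And>x. norm x > R \<Longrightarrow> f x = 0" "norm x > R"
  shows "pd i f x = 0"
  by (rule pd_eq_0_open[of "- cball 0 R" x f 0]) (use assms in auto)

lemma test_fun_pd: "test_fun \<phi> \<Longrightarrow> test_fun (pd i \<phi>)"
  by (frule test_fun_smooth, erule test_funE) (rule test_funI, auto intro: smooth_pd pd_eq_0_outside)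

lemma test_fun_mult: "test_fun \<phi> \<Longrightarrow> smooth f \<Longrightarrow> test_fun (\<lambda>x. f x * \<phi> x)" for \<phi> :: "_ \<Rightarrow> real"
  by (frule test_fun_smooth, erule test_funE) (intro test_funI smooth_mult, auto)

lemma test_fun_of_real: "test_fun \<phi> \<Longrightarrow> test_fun (\<lambda>x. complex_of_real (\<phi> x))"
  by (frule test_fun_smooth, erule test_funE) (intro test_funI smooth_of_real, auto)

lemma test_fun_affine:
  fixes \<phi> :: "real^'n \<Rightarrow> real"
  assumes "test_fun \<phi>" "s \<noteq> 0"
  shows "test_fun (\<lambda>x. \<phi> (c + s *\<^sub>R x))"
proof -
  obtain R where R: "\<And>x. norm x > R \<Longrightarrow> \<phi> x = 0" using assms(1) by (rule test_funE) blast
  have "\<phi> (c + s *\<^sub>R x) = 0" if "norm x > (R + norm c) / \<bar>s\<bar>" for x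
  proof (rule R)
    have "R + norm c < norm (s *\<^sub>R x)" using that assms(2) by (simp add: field_simps)
    also have "\<dots> \<le> norm (c + s *\<^sub>R x) + norm c"
      using norm_triangle_ineq4[of "c + s *\<^sub>R x" c] by simp
    finally show "R < norm (c + s *\<^sub>R x)" by simp
  qed
  then show ?thesis 
    by (rule test_funI[OF smooth_affine[OF test_fun_smooth[OF assms(1)]]])
qed

lemma test_fun_bounded:
  assumes "test_fun \<phi>"
  obtains B where "B > 0" "\<And>x. norm (\<phi> x) \<le> B"
proof -
  obtain R where R: "\<And>x. norm x > R \<Longrightarrow> \<phi> x = 0" using assms by (rule test_funE) blast
  have "compact (\<phi> ` cball 0 R)"
    using smooth_continuous[OF test_fun_smooth[OF assms]]
    by (intro compact_continuous_image) (auto intro: continuous_on_subset)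
  then obtain B where "B > 0" "\<And>x. x \<in> cball 0 R \<Longrightarrow> norm (\<phi> x) \<le> B"
    using compact_imp_bounded bounded_pos by (metis imageI)
  then show ?thesis using R that by (metis less_eq_real_def linorder_not_le mem_cball_0 norm_zero)
qed

text \<open>Composing the bump with itself flattens it at height 1 near the origin.\<close>

lemma exists_cutoff:
  obtains \<eta> :: "real^'n::finite \<Rightarrow> real"
  where "smooth \<eta>" "\<And>x. 0 \<le> \<eta> x" "\<And>x. \<eta> x \<le> 1"
    "\<And>x. norm x \<le> 1 \<Longrightarrow> \<eta> x = 1" "\<And>x. norm x \<ge> 2 \<Longrightarrow> \<eta> x = 0"
proof -
  \<comment> \<open>On the unit ball 4 - |x|^2 is at least 3, so the inner bump reaches
    \<open>a\<close>, the outer one vanishes and \<eta> = 1. For |x| at least 2 the inner bump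
    vanishes, the outer one equals \<open>b\<close> and \<eta> = 0.\<close>
  define a where "a = exp_bump 0 3"
  define b where "b = exp_bump 0 a"
  define \<eta> :: "real^'n \<Rightarrow> real"
    where "\<eta> x = 1 - (1 / b) * exp_bump 0 (a - exp_bump 0 (4 - (norm x)\<^sup>2))" for x
  have "a > 0" by (simp add: a_def exp_bump_pos_iff)
  then have "b > 0" by (simp add: b_def exp_bump_pos_iff)
  have "smooth \<eta>" unfolding \<eta>_def
    by (intro smooth_diff smooth_mult smooth_const smooth_exp_bump smooth_norm_power2)
  moreover have "\<eta> x \<le> 1" for x
    using \<open>b > 0\<close> exp_bump_nonneg by (simp add: \<eta>_def)
  moreover have "exp_bump 0 (a - exp_bump 0 (4 - (norm x)\<^sup>2)) \<le> b" for x :: "real^'n"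
    unfolding b_def by (rule exp_bump_0_mono) (simp add: exp_bump_nonneg)
  then have "0 \<le> \<eta> x" for x
    using \<open>b > 0\<close> by (simp add: \<eta>_def)
  moreover have "\<eta> x = 1" if "norm x \<le> 1" for x
  proof -
    have "(norm x)\<^sup>2 \<le> 1" using that by (simp add: power_le_one)
    then have "a \<le> exp_bump 0 (4 - (norm x)\<^sup>2)"
      unfolding a_def by (intro exp_bump_0_mono) simp
    then show ?thesis by (simp add: \<eta>_def exp_bump_def[of 0 "a - _"])
  qed
  moreover have "\<eta> x = 0" if "norm x \<ge> 2" for x
  proof -
    have "(norm x)\<^sup>2 \<ge> 4" using power_mono[OF that, of 2] by simp
    then have "exp_bump 0 (4 - (norm x)\<^sup>2) = 0"
      by (simp add: exp_bump_def)
    then show ?thesis using \<open>b > 0\<close> by (simp add: \<eta>_def flip: b_def)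
  qed
  ultimately show ?thesis using that by blast
qed

lemma test_fun_integrable:
  fixes \<phi> :: "real^'n \<Rightarrow> 'b::{banach,second_countable_topology}"
  assumes "test_fun \<phi>"
  shows "integrable lborel \<phi>"
proof -
  obtain R where R: "\<And>x. norm x > R \<Longrightarrow> \<phi> x = 0" using assms by (rule test_funE) blast
  have "set_integrable lborel (cball 0 R) \<phi>"
    unfolding set_integrable_def using smooth_continuous[OF test_fun_smooth[OF assms]]
    by (intro borel_integrable_compact) (auto intro: continuous_on_subset)
  moreover have "(\<lambda>x. indicator (cball 0 R) x *\<^sub>R \<phi> x) = \<phi>"
    using R by (auto simp: indicator_def fun_eq_iff)
  ultimately show ?thesis by (simp add: set_integrable_def)
qed

text \<open>Normalise a radial bump. Its integral cannot vanish: a nonnegative function with zero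
  integral is zero almost everywhere, but this one is positive on a ball of positive volume.\<close>

lemma exists_mollifier:
  assumes "e > 0"
  obtains \<rho> :: "real^'n::finite \<Rightarrow> real"
  where "test_fun \<rho>" "\<And>x. \<rho> x \<ge> 0" "\<And>x. norm x \<ge> e \<Longrightarrow> \<rho> x = 0" "integral\<^sup>L lborel \<rho> = 1"
proof -
  define \<beta> :: "real^'n \<Rightarrow> real" where "\<beta> x = exp_bump 0 (e\<^sup>2 - (norm x)\<^sup>2)" for x
  have \<beta>0: "\<beta> x = 0" if "norm x \<ge> e" for x
  proof -
    have "e\<^sup>2 \<le> (norm x)\<^sup>2" using that assms by (intro power_mono) auto
    then show ?thesis by (simp add: \<beta>_def exp_bump_def)
  qed
  have sm: "smooth \<beta>"
    unfolding \<beta>_def by (intro smooth_diff smooth_const smooth_exp_bump smooth_norm_power2)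
  then have test: "test_fun \<beta>" by (rule test_funI[of _ e]) (simp add: \<beta>0)
  have int: "integrable lborel \<beta>" by (rule test_fun_integrable[OF test])
  have nn: "\<beta> x \<ge> 0" for x by (simp add: \<beta>_def exp_bump_nonneg)
  have "integral\<^sup>L lborel \<beta> \<noteq> 0"
  proof
    assume "integral\<^sup>L lborel \<beta> = 0"
    then have "AE x in lborel. \<beta> x = 0"
      using integral_nonneg_eq_0_iff_AE[OF int] nn by simp
    moreover have "\<beta> x > 0" if "norm x < e" for x
      using power_strict_mono[OF that, of 2] by (simp add: \<beta>_def exp_bump_pos_iff)
    then have "x \<notin> ball 0 e" if "\<beta> x = 0" for x
      using that by (metis less_irrefl mem_ball_0)
    ultimately have "AE x in lborel. x \<notin> ball (0::real^'n) e"
      by (auto elim: eventually_mono)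
    then have "emeasure lborel (ball (0::real^'n) e) = 0"
      by (subst (asm) AE_iff_measurable[OF _ refl]) (auto simp: ball_def)
    then show False using content_ball_pos[OF assms, of "0::real^'n"] by (simp add: measure_def)
  qed
  then have pos: "integral\<^sup>L lborel \<beta> > 0"
    using Bochner_Integration.integral_nonneg[of lborel \<beta>] nn by (simp add: less_eq_real_def)
  show ?thesis
  proof
    show "test_fun (\<lambda>x. (1 / integral\<^sup>L lborel \<beta>) * \<beta> x)"
      by (intro test_fun_mult test smooth_const)
  qed (use pos nn \<beta>0 int in auto)
qed

section \<open>Continuity of translations in the mean\<close>

lemma integrable_shift:
  fixes f :: "'a::euclidean_space \<Rightarrow> 'b::{banach,second_countable_topology}"
  assumes "integrable lborel f"
  shows "integrable lborel (\<lambda>x. f (x + z))"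
proof -
  have "integrable (distr lborel borel ((+) z)) f"
    using assms by (simp add: lborel_distr_plus)
  then show ?thesis
    by (subst (asm) integrable_distr_eq) (use assms in \<open>auto simp: add.commute\<close>)
qed

lemma integral_shift:
  fixes f :: "'a::euclidean_space \<Rightarrow> 'b::{banach,second_countable_topology}"
  assumes "f \<in> borel_measurable borel"
  shows "(\<integral>x. f (x + z) \<partial>lborel) = (\<integral>x. f x \<partial>lborel)"
proof -
  have "(\<integral>x. f x \<partial>lborel) = (\<integral>x. f x \<partial>distr lborel borel ((+) z))"
    by (simp add: lborel_distr_plus)
  also have "\<dots> = (\<integral>x. f (x + z) \<partial>lborel)"
    using assms by (subst integral_distr) (auto simp: add.commute)
  finally show ?thesis ..
qed

definition L1_modulus :: "('a::euclidean_space \<Rightarrow> 'b::{banach,second_countable_topology}) \<Rightarrow> 'a \<Rightarrow> real" where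
  "L1_modulus f z = (\<integral>x. norm (f (x + z) - f x) \<partial>lborel)"

text \<open>Translations preserve the L^1 norm, so replacing \<open>f\<close> by \<open>g\<close>
  costs twice their distance, uniformly in the shift. An approximation within e/4 leaves e/2 for the
  modulus of \<open>g\<close>.\<close>

lemma L1_modulus_approx:
  fixes f :: "'a::euclidean_space \<Rightarrow> 'b::{banach,second_countable_topology}"
  assumes f: "integrable lborel f"
    and approx: "\<And>e. e > 0 \<Longrightarrow> \<exists>g. integrable lborel g \<and> (\<integral>x. norm (f x - g x) \<partial>lborel) < e \<and>
      (\<lambda>n. L1_modulus g (z n)) \<longlonglongrightarrow> 0"
  shows "(\<lambda>n. L1_modulus f (z n)) \<longlonglongrightarrow> 0"
proof (rule tendstoI)
  fix e :: real assume "e > 0"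
  then obtain g where g: "integrable lborel g" and fg: "(\<integral>x. norm (f x - g x) \<partial>lborel) < e / 4"
    and lim: "(\<lambda>n. L1_modulus g (z n)) \<longlonglongrightarrow> 0"
    using approx[of "e / 4"] by auto
  have le: "L1_modulus f y \<le> 2 * (\<integral>x. norm (f x - g x) \<partial>lborel) + L1_modulus g y" for y
  proof -
    note [measurable] = borel_measurable_integrable[OF f] borel_measurable_integrable[OF g]
    have i: "integrable lborel (\<lambda>x. norm (f x - g x))"
      "integrable lborel (\<lambda>x. norm (f (x + y) - g (x + y)))"
      "integrable lborel (\<lambda>x. norm (g (x + y) - g x))"
      by (intro integrable_norm Bochner_Integration.integrable_diff integrable_shift f g)+
    have "L1_modulus f y \<le> (\<integral>x. norm (f x - g x) + norm (f (x + y) - g (x + y))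
        + norm (g (x + y) - g x) \<partial>lborel)"
      unfolding L1_modulus_def
    proof (rule integral_mono)
      fix x
      have "f (x + y) - f x = (f (x + y) - g (x + y)) + (g (x + y) - g x) - (f x - g x)" by simp
      then show "norm (f (x + y) - f x) \<le> norm (f x - g x) + norm (f (x + y) - g (x + y)) + norm (g (x + y) - g x)"
        using norm_triangle_ineq4[of "(f (x + y) - g (x + y)) + (g (x + y) - g x)" "f x - g x"]
          norm_triangle_ineq[of "f (x + y) - g (x + y)" "g (x + y) - g x"] by simp
    next
      show "integrable lborel (\<lambda>x. norm (f (x + y) - f x))"
        by (intro integrable_norm Bochner_Integration.integrable_diff integrable_shift f)
      show "integrable lborel (\<lambda>x. norm (f x - g x) + norm (f (x + y) - g (x + y)) + norm (g (x + y) - g x))"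
        by (intro Bochner_Integration.integrable_add i)
    qed
    also have "\<dots> = (\<integral>x. norm (f x - g x) \<partial>lborel) + (\<integral>x. norm (f (x + y) - g (x + y)) \<partial>lborel)
        + L1_modulus g y"
      using i by (simp add: L1_modulus_def)
    also have "(\<integral>x. norm (f (x + y) - g (x + y)) \<partial>lborel) = (\<integral>x. norm (f x - g x) \<partial>lborel)"
      by (rule integral_shift[of "\<lambda>x. norm (f x - g x)"]) measurable
    finally show ?thesis by simp
  qed
  have nn: "L1_modulus f y \<ge> 0" for y unfolding L1_modulus_def by (rule Bochner_Integration.integral_nonneg) simp
  have "eventually (\<lambda>n. L1_modulus g (z n) < e / 2) sequentially"
    using order_tendstoD(2)[OF lim, of "e / 2"] \<open>e > 0\<close> by simp
  then show "eventually (\<lambda>n. dist (L1_modulus f (z n)) 0 < e) sequentially"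
  proof eventually_elim
    case (elim n)
    with le[of "z n"] fg nn[of "z n"] show ?case by (simp add: dist_norm)
  qed
qed

text \<open>Openness makes the indicator stable: a point of \<open>U\<close> stays in
  \<open>U\<close> under all small shifts, so dominated convergence handles the part of
  \<open>U\<close> that the shift throws out. The other half of the symmetric difference is the same
  quantity for the opposite shift, by translation invariance.\<close>

lemma L1_modulus_open:
  fixes U :: "'a::euclidean_space set" and c :: "'b::{banach,second_countable_topology}"
  assumes U: "open U" and fin: "emeasure lborel U < \<infinity>" and z: "z \<longlonglongrightarrow> 0"
  shows "(\<lambda>n. L1_modulus (\<lambda>x. indicator U x *\<^sub>R c) (z n)) \<longlonglongrightarrow> 0"
proof -
  have [measurable]: "U \<in> sets borel" using U by simp
  have iU: "integrable lborel (indicat_real U)"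
    using fin by (simp add: integrable_indicator_iff)
  define \<alpha> where "\<alpha> y = (\<integral>x. indicat_real U x * (1 - indicat_real U (x + y)) \<partial>lborel)" for y
  have \<alpha>_lim: "(\<lambda>n. \<alpha> (y n)) \<longlonglongrightarrow> 0" if y: "y \<longlonglongrightarrow> 0" for y
  proof -
    have "(\<lambda>n. \<alpha> (y n)) \<longlonglongrightarrow> (\<integral>x. (0::real) \<partial>(lborel :: 'a measure))"
      unfolding \<alpha>_def
    proof (rule integral_dominated_convergence[where w = "indicat_real U"])
      show "AE x in lborel. (\<lambda>n. indicat_real U x * (1 - indicat_real U (x + y n))) \<longlonglongrightarrow> 0"
      proof (rule AE_I2)
        fix x
        show "(\<lambda>n. indicat_real U x * (1 - indicat_real U (x + y n))) \<longlonglongrightarrow> 0"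
        proof (cases "x \<in> U")
          case True
          have "(\<lambda>n. x + y n) \<longlonglongrightarrow> x + 0" by (intro tendsto_intros y)
          then have "eventually (\<lambda>n. x + y n \<in> U) sequentially"
            using topological_tendstoD[OF _ U] True by auto
          then have "eventually (\<lambda>n. 0 = indicat_real U x * (1 - indicat_real U (x + y n))) sequentially"
            by eventually_elim simp
          then show ?thesis by (rule Lim_transform_eventually[OF tendsto_const])
        qed simp
      qed
    qed (use iU in \<open>auto simp: indicator_def\<close>)
    then show ?thesis by simp
  qed
  have i: "integrable lborel (\<lambda>x. indicat_real U x * (1 - indicat_real U (x + y)))" for y
    by (rule Bochner_Integration.integrable_bound[OF iU]) (auto simp: indicator_def)
  have "L1_modulus (\<lambda>x. indicator U x *\<^sub>R c) y = norm c * (\<alpha> y + \<alpha> (- y))" for y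
  proof -
    have "norm (indicat_real U (x + y) *\<^sub>R c - indicat_real U x *\<^sub>R c) =
      norm c * (indicat_real U x * (1 - indicat_real U (x + y))
        + indicat_real U (x + y) * (1 - indicat_real U ((x + y) + - y)))" for x
      by (auto simp: indicator_def)
    then have "L1_modulus (\<lambda>x. indicator U x *\<^sub>R c) y = (\<integral>x. norm c * (indicat_real U x * (1 - indicat_real U (x + y))
        + indicat_real U (x + y) * (1 - indicat_real U ((x + y) + - y))) \<partial>lborel)"
      unfolding L1_modulus_def by presburger
    also have "\<dots> = norm c * (\<alpha> y + (\<integral>x. indicat_real U (x + y) * (1 - indicat_real U ((x + y) + - y)) \<partial>lborel))"
      using i integrable_shift[OF i[of "- y"], of y]
      by (simp add: \<alpha>_def)
    also have "(\<integral>x. indicat_real U (x + y) * (1 - indicat_real U ((x + y) + - y)) \<partial>lborel) = \<alpha> (- y)"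
      unfolding \<alpha>_def
      by (rule integral_shift[of "\<lambda>x. indicat_real U x * (1 - indicat_real U (x + - y))"]) measurable
    finally show ?thesis .
  qed
  moreover have "(\<lambda>n. norm c * (\<alpha> (z n) + \<alpha> (- z n))) \<longlonglongrightarrow> norm c * (0 + 0)"
    using z tendsto_minus[OF z] by (intro tendsto_intros \<alpha>_lim) auto
  ultimately show ?thesis by simp
qed

text \<open>Measurable induction: outer regularity reduces Borel sets of finite measure to open
  sets, sums follow from the triangle inequality, and limits from L^1 approximation.\<close>

lemma L1_modulus_tendsto:
  fixes f :: "'a::euclidean_space \<Rightarrow> 'b::{banach,second_countable_topology}"
  assumes "integrable lborel f" and z: "z \<longlonglongrightarrow> 0"
  shows "(\<lambda>n. L1_modulus f (z n)) \<longlonglongrightarrow> 0"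
  using assms(1)
proof (induction rule: integrable_induct)
  case (base A c)
  have iA: "integrable lborel (\<lambda>x. indicat_real A x *\<^sub>R c)"
    using base by (intro integrable_scaleR_left) (auto simp: integrable_indicator_iff)
  show ?case
  proof (rule L1_modulus_approx[OF iA])
    fix e :: real assume "e > 0"
    \<comment> \<open>Adding 1 to the denominator covers c = 0 and makes the resulting bound
      strict.\<close>
    define d where "d = e / (norm c + 1)"
    have "d > 0" using \<open>e > 0\<close> norm_ge_zero[of c] by (simp add: d_def add_nonneg_pos)
    have "A \<in> sets lebesgue" using base(1) by auto
    then obtain U where U: "open U" "A \<subseteq> U" and dU: "emeasure lebesgue (U - A) < ennreal d"
      by (rule sets_lebesgue_outer_open[OF _ \<open>d > 0\<close>])
    have [measurable]: "A \<in> sets borel" "U \<in> sets borel" using base(1) U by auto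
    have dU': "emeasure lborel (U - A) < ennreal d"
      using dU by simp
    have "emeasure lborel U = emeasure lborel A + emeasure lborel (U - A)"
      using U(2) by (subst plus_emeasure) (auto simp: Un_absorb1)
    also have "\<dots> < \<infinity>" using base(2) order.strict_trans[OF dU' ennreal_less_top] by auto
    finally have finU: "emeasure lborel U < \<infinity>" .
    then have iU: "integrable lborel (\<lambda>x. indicat_real U x *\<^sub>R c)"
      by (intro integrable_scaleR_left) (auto simp: integrable_indicator_iff)
    have "norm (indicat_real A x *\<^sub>R c - indicat_real U x *\<^sub>R c) = norm c * indicat_real (U - A) x" for x
      using U(2) by (auto simp: indicator_def)
    then have "(\<integral>x. norm (indicat_real A x *\<^sub>R c - indicat_real U x *\<^sub>R c) \<partial>lborel)
        = norm c * measure lborel (U - A)"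
      by simp
    also have "\<dots> \<le> norm c * d"
      using dU' \<open>d > 0\<close> by (intro mult_left_mono) (auto simp: measure_def enn2real_leI less_imp_le)
    also have "\<dots> < (norm c + 1) * d" using \<open>d > 0\<close> by simp
    also have "\<dots> = e"
      by (simp add: d_def add_nonneg_eq_0_iff)
    finally have "(\<integral>x. norm (indicat_real A x *\<^sub>R c - indicat_real U x *\<^sub>R c) \<partial>lborel) < e" .
    then show "\<exists>g. integrable lborel g \<and> (\<integral>x. norm (indicat_real A x *\<^sub>R c - g x) \<partial>lborel) < e \<and>
      (\<lambda>n. L1_modulus g (z n)) \<longlonglongrightarrow> 0"
      using iU L1_modulus_open[OF U(1) finU z] by blast
  qed
next
  case (add f g)
  show ?case
  proof (rule tendsto_sandwich[OF _ _ tendsto_const])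
    have "L1_modulus (\<lambda>x. f x + g x) y \<le> L1_modulus f y + L1_modulus g y" for y
    proof -
      have i: "integrable lborel (\<lambda>x. norm (f (x + y) - f x))" "integrable lborel (\<lambda>x. norm (g (x + y) - g x))"
        "integrable lborel (\<lambda>x. norm ((f (x + y) + g (x + y)) - (f x + g x)))"
        by (intro integrable_norm Bochner_Integration.integrable_diff Bochner_Integration.integrable_add
            integrable_shift add)+
      have "L1_modulus (\<lambda>x. f x + g x) y \<le> (\<integral>x. norm (f (x + y) - f x) + norm (g (x + y) - g x) \<partial>lborel)"
        unfolding L1_modulus_def
        by (intro integral_mono i Bochner_Integration.integrable_add norm_diff_triangle_ineq)
      also have "\<dots> = L1_modulus f y + L1_modulus g y"
        unfolding L1_modulus_def using i by simp
      finally show ?thesis .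
    qed
    then show "eventually (\<lambda>n. L1_modulus (\<lambda>x. f x + g x) (z n) \<le> L1_modulus f (z n) + L1_modulus g (z n)) sequentially"
      by simp
    show "(\<lambda>n. L1_modulus f (z n) + L1_modulus g (z n)) \<longlonglongrightarrow> 0"
      using tendsto_add[OF add.IH] by simp
  qed (auto simp: L1_modulus_def)
next
  case (lim f s)
  show ?case
  proof (rule L1_modulus_approx[OF lim.hyps(4)])
    fix e :: real assume "e > 0"
    \<comment> \<open>The factor 3 in the dominating function comes from the induction rule, whose
      approximants satisfy |s_i| \<le> 2 |f|.\<close>
    have "(\<lambda>i. \<integral>x. norm (f x - s i x) \<partial>lborel) \<longlonglongrightarrow> (\<integral>x. (0::real) \<partial>(lborel :: 'a measure))"
    proof (rule integral_dominated_convergence[where w = "\<lambda>x. 3 * norm (f x)"])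
      show "AE x in lborel. (\<lambda>i. norm (f x - s i x)) \<longlonglongrightarrow> 0"
      proof (rule AE_I2)
        fix x
        have "(\<lambda>i. f x - s i x) \<longlonglongrightarrow> f x - f x"
          using lim.hyps(2)[of x] by (intro tendsto_intros) simp
        then show "(\<lambda>i. norm (f x - s i x)) \<longlonglongrightarrow> 0"
          by (simp add: tendsto_norm_zero)
      qed
      show "AE x in lborel. norm (norm (f x - s i x)) \<le> 3 * norm (f x)" for i
      proof (rule AE_I2)
        fix x
        show "norm (norm (f x - s i x)) \<le> 3 * norm (f x)"
          using lim.hyps(3)[of x i] norm_triangle_ineq4[of "f x" "s i x"] by simp
      qed
    qed (use lim.hyps(1,4) in auto)
    then have "eventually (\<lambda>i. (\<integral>x. norm (f x - s i x) \<partial>lborel) < e) sequentially"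
      using \<open>e > 0\<close> by (intro order_tendstoD(2)) auto
    then obtain i where "(\<integral>x. norm (f x - s i x) \<partial>lborel) < e"
      by (auto simp: eventually_sequentially)
    then show "\<exists>g. integrable lborel g \<and> (\<integral>x. norm (f x - g x) \<partial>lborel) < e \<and>
      (\<lambda>n. L1_modulus g (z n)) \<longlonglongrightarrow> 0"
      using lim.hyps(1) lim.IH by blast
  qed
qed

text \<open>Strong monotonicity of the map a \<mapsto> |a| a. Twice the inner product of the
  difference of images with a - b equals (|a| + |b|) |a - b|^2 plus a nonnegative term. Bound |a| +
  |b| below by |a - b|, apply Cauchy-Schwarz and divide by |a - b|.\<close>

lemma norm_diff_square_le:
  fixes a b :: "'a::real_inner"
  shows "(norm (a - b))\<^sup>2 \<le> 2 * norm (norm a *\<^sub>R a - norm b *\<^sub>R b)"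
proof (cases "a = b")
  case False
  let ?v = "norm a *\<^sub>R a - norm b *\<^sub>R b"
  have sq: "(norm (a - b))\<^sup>2 = (norm a)\<^sup>2 - 2 * (a \<bullet> b) + (norm b)\<^sup>2"
    by (simp add: power2_norm_eq_inner algebra_simps inner_commute)
  have "2 * (?v \<bullet> (a - b)) = (norm a + norm b) * (norm (a - b))\<^sup>2
      + (norm a - norm b) * ((norm a)\<^sup>2 - (norm b)\<^sup>2)"
    unfolding sq by (simp add: algebra_simps inner_commute flip: power2_norm_eq_inner)
  also have "(norm a - norm b) * ((norm a)\<^sup>2 - (norm b)\<^sup>2) = (norm a - norm b)\<^sup>2 * (norm a + norm b)"
    by (simp add: power2_eq_square algebra_simps)
  finally have "(norm a + norm b) * (norm (a - b))\<^sup>2 \<le> 2 * (?v \<bullet> (a - b))"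
    by simp
  moreover have "norm (a - b) * (norm (a - b))\<^sup>2 \<le> (norm a + norm b) * (norm (a - b))\<^sup>2"
    by (intro mult_right_mono norm_triangle_ineq4) simp
  moreover have "?v \<bullet> (a - b) \<le> norm ?v * norm (a - b)"
    by (rule norm_cauchy_schwarz)
  ultimately have "norm (a - b) * (norm (a - b))\<^sup>2 \<le> norm (a - b) * (2 * norm ?v)"
    by (simp add: mult.commute)
  with False show ?thesis by simp
qed simp

text \<open>Continuity of translations in $L^2$ is reduced to $L^1$ by the nonlinear map
  $u \mapsto |u| u$.\<close>

lemma L2_modulus_tendsto:
  fixes u :: "'a::euclidean_space \<Rightarrow> complex"
  assumes [measurable]: "u \<in> borel_measurable borel"
    and u2: "integrable lborel (\<lambda>x. (norm (u x))\<^sup>2)" and z: "z \<longlonglongrightarrow> 0"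
  shows "(\<lambda>n. \<integral>x. (norm (u (x + z n) - u x))\<^sup>2 \<partial>lborel) \<longlonglongrightarrow> 0"
proof -
  let ?v = "\<lambda>x. norm (u x) *\<^sub>R u x"
  have iv: "integrable lborel ?v"
    by (rule Bochner_Integration.integrable_bound[OF u2]) (auto simp: power2_eq_square)
  have le: "(\<integral>x. (norm (u (x + y) - u x))\<^sup>2 \<partial>lborel) \<le> 2 * L1_modulus ?v y" for y
  proof -
    have i: "integrable lborel (\<lambda>x. 2 * norm (?v (x + y) - ?v x))"
      by (intro integrable_mult_right integrable_norm Bochner_Integration.integrable_diff
          integrable_shift[OF iv] iv)
    have "(\<integral>x. (norm (u (x + y) - u x))\<^sup>2 \<partial>lborel) \<le> (\<integral>x. 2 * norm (?v (x + y) - ?v x) \<partial>lborel)"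
      by (rule integral_mono_AE'[OF i]) (auto intro: norm_diff_square_le)
    then show ?thesis by (simp add: L1_modulus_def)
  qed
  have lim: "(\<lambda>n. 2 * L1_modulus ?v (z n)) \<longlonglongrightarrow> 0"
    using tendsto_mult_right_zero[OF L1_modulus_tendsto[OF iv z]] .
  show ?thesis
    by (rule tendsto_sandwich[OF _ _ tendsto_const lim]) (auto intro!: always_eventually le)
qed

section \<open>Mollification and testing against Sobolev functions\<close>

text \<open>The Borel counterpart of \<open>loc_L2\<close>. Mollification rests on Fubini over
  \<open>lborel \<Otimes>\<^sub>M lborel\<close>, where joint measurability comes from Borel
  measurable factors; Lebesgue measurable data are moved here through almost everywhere equal
  representatives.\<close>

definition loc_sq_int :: "('a::euclidean_space \<Rightarrow> complex) \<Rightarrow> bool" where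
  "loc_sq_int u \<longleftrightarrow> u \<in> borel_measurable borel \<and>
    (\<forall>R. integrable lborel (\<lambda>x. indicator (cball 0 R) x * (cmod (u x))\<^sup>2))"

lemma mult_le_half_squares: "a * b \<le> (a\<^sup>2 + b\<^sup>2) / 2" for a b :: real
  using sum_squares_bound[of a b] by simp

lemma norm_mult_le_squares:
  "norm (a * b) \<le> (norm a)\<^sup>2 + (norm b)\<^sup>2" for a b :: "'a::real_normed_algebra"
proof -
  have "norm (a * b) \<le> norm a * norm b" by (rule norm_mult_ineq)
  also have "\<dots> \<le> ((norm a)\<^sup>2 + (norm b)\<^sup>2) / 2" by (rule mult_le_half_squares)
  also have "\<dots> \<le> (norm a)\<^sup>2 + (norm b)\<^sup>2" by simp
  finally show ?thesis .
qed

lemma integrable_mult_sq: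
  fixes f g :: "'a \<Rightarrow> complex"
  assumes [measurable]: "f \<in> borel_measurable M" "g \<in> borel_measurable M"
    and "integrable M (\<lambda>x. (cmod (f x))\<^sup>2)" "integrable M (\<lambda>x. (cmod (g x))\<^sup>2)"
  shows "integrable M (\<lambda>x. f x * g x)"
  by (rule Bochner_Integration.integrable_bound[OF Bochner_Integration.integrable_add[OF assms(3,4)]])
    (auto intro!: AE_I2 order_trans[OF norm_mult_le_squares])

text \<open>On the ball carrying \<open>h\<close>, which has finite measure, |h| \<le> 1 +
  |h|^2.\<close>

lemma sq_int_imp_integrable:
  fixes h :: "'a::euclidean_space \<Rightarrow> complex"
  assumes [measurable]: "h \<in> borel_measurable borel" and h2: "integrable lborel (\<lambda>x. (cmod (h x))\<^sup>2)"
    and supp: "\<And>x. norm x > R \<Longrightarrow> h x = 0"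
  shows "integrable lborel h"
proof -
  have "integrable lborel (indicat_real (cball (0::'a) R))"
    using emeasure_lborel_cball_finite by (simp add: integrable_indicator_iff)
  then show ?thesis
  proof (rule Bochner_Integration.integrable_bound[OF Bochner_Integration.integrable_add[OF _ h2]])
    show "AE x in lborel. norm (h x) \<le> norm (indicat_real (cball 0 R) x + (cmod (h x))\<^sup>2)"
    proof (rule AE_I2)
      fix x
      show "norm (h x) \<le> norm (indicat_real (cball 0 R) x + (cmod (h x))\<^sup>2)"
      proof (cases "norm x > R")
        case False
        have "2 * cmod (h x) \<le> 1 + (cmod (h x))\<^sup>2"
          using mult_le_half_squares[of 1 "cmod (h x)"] by simp
        moreover have "0 \<le> cmod (h x)" by simp
        ultimately have "cmod (h x) \<le> 1 + (cmod (h x))\<^sup>2" by linarith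
        with False show ?thesis by simp
      qed (simp add: supp)
    qed
  qed simp
qed

lemma loc_sq_int_truncate:
  fixes u :: "'a::euclidean_space \<Rightarrow> complex"
  assumes "loc_sq_int u"
  shows "(\<lambda>x. indicator (cball 0 R) x *\<^sub>R u x) \<in> borel_measurable borel"
    and "integrable lborel (\<lambda>x. (cmod (indicator (cball 0 R) x *\<^sub>R u x))\<^sup>2)"
    and "integrable lborel (\<lambda>x. indicator (cball 0 R) x *\<^sub>R u x)"
proof -
  have [measurable]: "u \<in> borel_measurable borel" using assms by (simp add: loc_sq_int_def)
  show 1: "(\<lambda>x. indicator (cball 0 R) x *\<^sub>R u x) \<in> borel_measurable borel"
    by (intro borel_measurable_scaleR borel_measurable_indicator) auto
  have "(\<lambda>x. (cmod (indicator (cball 0 R) x *\<^sub>R u x))\<^sup>2) = (\<lambda>x. indicator (cball 0 R) x * (cmod (u x))\<^sup>2)"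
    by (auto simp: indicator_def)
  then show 2: "integrable lborel (\<lambda>x. (cmod (indicator (cball 0 R) x *\<^sub>R u x))\<^sup>2)"
    using assms by (simp add: loc_sq_int_def)
  show "integrable lborel (\<lambda>x. indicator (cball 0 R) x *\<^sub>R u x)"
    by (rule sq_int_imp_integrable[OF 1 2, of R]) (simp add: indicator_def)
qed

lemma test_fun_measurable: "test_fun \<phi> \<Longrightarrow> \<phi> \<in> borel_measurable borel"
  by (intro borel_measurable_continuous_onI smooth_continuous test_fun_smooth)

lemma loc_sq_int_mult_test_fun:
  fixes \<psi> :: "real^'n \<Rightarrow> real"
  assumes u: "loc_sq_int u" and \<psi>: "test_fun \<psi>" and supp: "\<And>x. norm x > R \<Longrightarrow> \<psi> x = 0"
  shows "(\<lambda>x. u x * complex_of_real (\<psi> x)) \<in> borel_measurable borel"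
    and "integrable lborel (\<lambda>x. (cmod (u x * complex_of_real (\<psi> x)))\<^sup>2)"
    and "integrable lborel (\<lambda>x. u x * complex_of_real (\<psi> x))"
proof -
  have [measurable]: "u \<in> borel_measurable borel" using u by (simp add: loc_sq_int_def)
  note [measurable] = test_fun_measurable[OF \<psi>]
  obtain B where B: "B > 0" "\<And>x. norm (\<psi> x) \<le> B" using \<psi> by (rule test_fun_bounded) blast
  show 1: "(\<lambda>x. u x * complex_of_real (\<psi> x)) \<in> borel_measurable borel" by measurable
  show 2: "integrable lborel (\<lambda>x. (cmod (u x * complex_of_real (\<psi> x)))\<^sup>2)"
  proof (rule Bochner_Integration.integrable_bound[OF integrable_mult_right[OF loc_sq_int_truncate(2)[OF u]]])
    show "AE x in lborel. norm ((cmod (u x * complex_of_real (\<psi> x)))\<^sup>2)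
        \<le> norm (B\<^sup>2 * (cmod (indicator (cball 0 R) x *\<^sub>R u x))\<^sup>2)"
    proof (rule AE_I2)
      fix x
      show "norm ((cmod (u x * complex_of_real (\<psi> x)))\<^sup>2) \<le> norm (B\<^sup>2 * (cmod (indicator (cball 0 R) x *\<^sub>R u x))\<^sup>2)"
      proof (cases "norm x > R")
        case False
        have "(\<psi> x)\<^sup>2 \<le> B\<^sup>2" using B(2)[of x] B(1) abs_le_square_iff[of "\<psi> x" B] by simp
        then show ?thesis using False
          by (simp add: norm_mult power_mult_distrib mult.commute[of _ "(\<psi> x)\<^sup>2"] mult_right_mono)
      qed (simp add: supp)
    qed
  qed measurable
  show "integrable lborel (\<lambda>x. u x * complex_of_real (\<psi> x))"
    by (rule sq_int_imp_integrable[OF 1 2, of R]) (simp add: supp)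
qed

section \<open>Convergence of mollified functions paired with a compactly supported weight\<close>

lemma integrable_pair_mult:
  fixes a :: "'a::euclidean_space \<Rightarrow> real" and b :: "'b::euclidean_space \<Rightarrow> real"
  assumes a: "integrable lborel a" and b: "integrable lborel b"
  shows "integrable (lborel \<Otimes>\<^sub>M lborel) (\<lambda>(y, x). a y * b x)"
proof (rule lborel_pair.Fubini_integrable)
  note [measurable] = borel_measurable_integrable[OF a] borel_measurable_integrable[OF b]
  show "(\<lambda>(y, x). a y * b x) \<in> borel_measurable (lborel \<Otimes>\<^sub>M lborel)" by measurable
  show "integrable lborel (\<lambda>y. \<integral>x. norm (case (y, x) of (y, x) \<Rightarrow> a y * b x) \<partial>lborel)"
    using a by (simp add: abs_mult)
  show "AE y in lborel. integrable lborel (\<lambda>x. case (y, x) of (y, x) \<Rightarrow> a y * b x)"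
    using b by simp
qed

text \<open>If h(x) and K(y - x) are both nonzero then |x| \<le> R and |y - x| \<le> S, so only |y|
  \<le> R + S matters. There B |u(y)| |h(x)| is an integrable majorant of product form, and the two
  integrals may be exchanged.\<close>

lemma mollify_Fubini:
  fixes h u :: "real^'n \<Rightarrow> complex" and K :: "real^'n \<Rightarrow> real"
  assumes h: "integrable lborel h" and supp: "\<forall>x. norm x > R \<longrightarrow> h x = 0"
    and u: "loc_sq_int u" and K: "test_fun K"
  shows "integrable lborel (\<lambda>y. u y * (\<integral>x. h x * complex_of_real (K (y - x)) \<partial>lborel))" (is ?I)
    and "(\<integral>y. u y * (\<integral>x. h x * complex_of_real (K (y - x)) \<partial>lborel) \<partial>lborel) =
      (\<integral>x. h x * (\<integral>y. u y * complex_of_real (K (y - x)) \<partial>lborel) \<partial>lborel)" (is ?E)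
proof -
  have [measurable]: "u \<in> borel_measurable borel" using u by (simp add: loc_sq_int_def)
  note [measurable] = test_fun_measurable[OF K] borel_measurable_integrable[OF h]
  obtain S where S: "\<And>x. norm x > S \<Longrightarrow> K x = 0" using K by (rule test_funE) blast
  obtain B where B: "B > 0" "\<And>x. norm (K x) \<le> B" using K by (rule test_fun_bounded) blast
  let ?u = "\<lambda>x. indicator (cball 0 (R + S)) x *\<^sub>R u x"
  have ui: "integrable lborel (\<lambda>y. B * norm (?u y))"
    by (intro integrable_mult_right integrable_norm loc_sq_int_truncate(3)[OF u])
  have int: "integrable (lborel \<Otimes>\<^sub>M lborel) (\<lambda>(y, x). u y * (h x * complex_of_real (K (y - x))))"
  proof (rule Bochner_Integration.integrable_bound[OF integrable_pair_mult[OF ui integrable_norm[OF h]]])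
    show "(\<lambda>(y, x). u y * (h x * complex_of_real (K (y - x)))) \<in> borel_measurable (lborel \<Otimes>\<^sub>M lborel)"
      by measurable
    show "AE p in lborel \<Otimes>\<^sub>M lborel. norm (case p of (y, x) \<Rightarrow> u y * (h x * complex_of_real (K (y - x))))
        \<le> norm (case p of (y, x) \<Rightarrow> B * norm (?u y) * norm (h x))"
    proof (rule AE_I2, clarify)
      fix y x
      show "norm (u y * (h x * complex_of_real (K (y - x)))) \<le> norm (B * norm (?u y) * norm (h x))"
      proof (cases "h x = 0 \<or> K (y - x) = 0")
        case False
        then have "norm x \<le> R" "norm (y - x) \<le> S" using supp S by force+
        then have "norm y \<le> R + S" using norm_triangle_ineq[of "y - x" x] by simp
        moreover have "cmod (u y) * (cmod (h x) * \<bar>K (y - x)\<bar>) \<le> cmod (u y) * (cmod (h x) * B)"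
          using B(2)[of "y - x"] by (intro mult_left_mono) auto
        ultimately show ?thesis using B(1) by (simp add: norm_mult mult_ac)
      qed auto
    qed
  qed
  have "integrable lborel (\<lambda>y. \<integral>x. u y * (h x * complex_of_real (K (y - x))) \<partial>lborel)"
    using lborel_pair.integrable_fst[OF int] .
  then show ?I by simp
  have "(\<integral>x. (\<integral>y. u y * (h x * complex_of_real (K (y - x))) \<partial>lborel) \<partial>lborel) =
      (\<integral>y. (\<integral>x. u y * (h x * complex_of_real (K (y - x))) \<partial>lborel) \<partial>lborel)"
    by (rule lborel_pair.Fubini_integral[OF int])
  moreover have "(\<integral>y. u y * (h x * complex_of_real (K (y - x))) \<partial>lborel) =
      h x * (\<integral>y. u y * complex_of_real (K (y - x)) \<partial>lborel)" for x
    by (simp add: mult.left_commute[of _ "h x"])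
  ultimately show ?E by simp
qed

text \<open>Cauchy-Schwarz in additive form: for a weight s the integral is at most s times the
  squared norm of \<open>h\<close> plus 1/s times the squared L^2 distance of \<open>u\<close> from
  its translate. Fix s first, then shrink the shift.\<close>

lemma correlation_tendsto:
  fixes h u :: "real^'n \<Rightarrow> complex"
  assumes [measurable]: "h \<in> borel_measurable borel" "u \<in> borel_measurable borel"
    and h2: "integrable lborel (\<lambda>x. (cmod (h x))\<^sup>2)" and u2: "integrable lborel (\<lambda>x. (cmod (u x))\<^sup>2)"
    and z: "z \<longlonglongrightarrow> 0"
  shows "(\<lambda>n. \<integral>x. h x * (u (x + z n) - u x) \<partial>lborel) \<longlonglongrightarrow> 0"
proof (rule tendstoI)
  fix e :: real assume "e > 0"
  define H where "H = (\<integral>x. (cmod (h x))\<^sup>2 \<partial>lborel)"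
  define T where "T y = (\<integral>x. (cmod (u (x + y) - u x))\<^sup>2 \<partial>lborel)" for y
  \<comment> \<open>With H + 1 in place of H the definition makes sense for h = 0, and s H < e/2 is
    strict.\<close>
  define s where "s = e / (2 * (H + 1))"
  have "H \<ge> 0" unfolding H_def by (rule Bochner_Integration.integral_nonneg) simp
  then have "s > 0" using \<open>e > 0\<close> by (simp add: s_def)
  have d2: "integrable lborel (\<lambda>x. (cmod (u (x + y) - u x))\<^sup>2)" for y
  proof (rule Bochner_Integration.integrable_bound)
    show "integrable lborel (\<lambda>x. 2 * (cmod (u (x + y)))\<^sup>2 + 2 * (cmod (u x))\<^sup>2)"
      by (intro Bochner_Integration.integrable_add integrable_mult_right u2 integrable_shift[OF u2])
    show "AE x in lborel. norm ((cmod (u (x + y) - u x))\<^sup>2) \<le> norm (2 * (cmod (u (x + y)))\<^sup>2 + 2 * (cmod (u x))\<^sup>2)"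
    proof (rule AE_I2)
      fix x
      have "(cmod (u (x + y) - u x))\<^sup>2 \<le> (cmod (u (x + y)) + cmod (u x))\<^sup>2"
        by (intro power_mono norm_triangle_ineq4) simp
      also have "\<dots> \<le> 2 * (cmod (u (x + y)))\<^sup>2 + 2 * (cmod (u x))\<^sup>2"
        using mult_le_half_squares[of "cmod (u (x + y))" "cmod (u x)"] by (simp add: power2_sum)
      finally show "norm ((cmod (u (x + y) - u x))\<^sup>2) \<le> norm (2 * (cmod (u (x + y)))\<^sup>2 + 2 * (cmod (u x))\<^sup>2)"
        by simp
    qed
  qed measurable
  have le: "cmod (\<integral>x. h x * (u (x + y) - u x) \<partial>lborel) \<le> s * H + T y / s" for y
  proof -
    have i: "integrable lborel (\<lambda>x. s * (cmod (h x))\<^sup>2 + (cmod (u (x + y) - u x))\<^sup>2 / s)"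
      by (intro Bochner_Integration.integrable_add integrable_mult_right h2 integrable_divide d2)
    have "cmod (\<integral>x. h x * (u (x + y) - u x) \<partial>lborel) \<le> (\<integral>x. cmod (h x * (u (x + y) - u x)) \<partial>lborel)"
      by (rule integral_norm_bound)
    also have "\<dots> \<le> (\<integral>x. s * (cmod (h x))\<^sup>2 + (cmod (u (x + y) - u x))\<^sup>2 / s \<partial>lborel)"
    proof (rule integral_mono_AE'[OF i])
      show "AE x in lborel. cmod (h x * (u (x + y) - u x)) \<le> s * (cmod (h x))\<^sup>2 + (cmod (u (x + y) - u x))\<^sup>2 / s"
      proof (rule AE_I2)
        fix x
        let ?a = "cmod (h x)" and ?b = "cmod (u (x + y) - u x)"
        have "?a * ?b = (sqrt s * ?a) * (?b / sqrt s)" using \<open>s > 0\<close> by simp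
        also have "\<dots> \<le> ((sqrt s * ?a)\<^sup>2 + (?b / sqrt s)\<^sup>2) / 2" by (rule mult_le_half_squares)
        also have "\<dots> \<le> s * ?a\<^sup>2 + ?b\<^sup>2 / s"
          using \<open>s > 0\<close> by (simp add: power_mult_distrib power_divide field_simps)
        finally show "cmod (h x * (u (x + y) - u x)) \<le> s * ?a\<^sup>2 + ?b\<^sup>2 / s" by (simp add: norm_mult)
      qed
    qed (use \<open>s > 0\<close> in simp)
    also have "\<dots> = s * H + T y / s"
      using h2 d2 by (simp add: H_def T_def)
    finally show ?thesis .
  qed
  have sH: "s * H < e / 2"
  proof -
    have "s * H < s * (H + 1)" using \<open>s > 0\<close> by simp
    also have "\<dots> = e / 2" using \<open>H \<ge> 0\<close> by (simp add: s_def field_simps add_nonneg_eq_0_iff)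
    finally show ?thesis .
  qed
  have "(\<lambda>n. T (z n)) \<longlonglongrightarrow> 0"
    unfolding T_def by (rule L2_modulus_tendsto[OF assms(2) u2 z])
  then have "eventually (\<lambda>n. T (z n) < s * (e / 2)) sequentially"
    using \<open>s > 0\<close> \<open>e > 0\<close> by (intro order_tendstoD(2)) auto
  then show "eventually (\<lambda>n. dist (\<integral>x. h x * (u (x + z n) - u x) \<partial>lborel) 0 < e) sequentially"
  proof eventually_elim
    case (elim n)
    then have "T (z n) / s < e / 2" using \<open>s > 0\<close> by (simp add: field_simps)
    with le[of "z n"] sH have "cmod (\<integral>x. h x * (u (x + z n) - u x) \<partial>lborel) < e" by linarith
    then show ?case by simp
  qed
qed

text \<open>Substituting y + x for y and exchanging integrals turns the mollified pairing into a
  \<rho>-average of pairings with translates of \<open>u\<close>. As \<rho> has mass one, the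
  unmollified pairing can be put under the same average, and the error becomes an average of the
  translation errors \<open>D\<close>.\<close>

lemma mollify_diff:
  fixes h u :: "real^'n \<Rightarrow> complex" and \<rho> :: "real^'n \<Rightarrow> real"
  assumes [measurable]: "h \<in> borel_measurable borel" "u \<in> borel_measurable borel"
    and h2: "integrable lborel (\<lambda>x. (cmod (h x))\<^sup>2)" and u2: "integrable lborel (\<lambda>x. (cmod (u x))\<^sup>2)"
    and \<rho>: "test_fun \<rho>" "\<And>x. \<rho> x \<ge> 0" "integral\<^sup>L lborel \<rho> = 1"
  defines "D \<equiv> \<lambda>y. \<integral>x. h x * (u (x + y) - u x) \<partial>lborel"
  shows "integrable lborel (\<lambda>y. complex_of_real (\<rho> y) * D y)"
    and "(\<integral>x. h x * (\<integral>y. u y * complex_of_real (\<rho> (y - x)) \<partial>lborel) \<partial>lborel) - (\<integral>x. h x * u x \<partial>lborel)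
      = (\<integral>y. complex_of_real (\<rho> y) * D y \<partial>lborel)"
proof -
  note [measurable] = test_fun_measurable[OF \<rho>(1)]
  have \<rho>i: "integrable lborel \<rho>" by (rule test_fun_integrable[OF \<rho>(1)])
  \<comment> \<open>By translation invariance \<open>J\<close> bounds the pairing of
    \<open>h\<close> with every translate of \<open>u\<close>, so a multiple of \<rho> dominates the
    inner integrals in the Fubini condition.\<close>
  define J where "J = (\<integral>x. (cmod (h x))\<^sup>2 \<partial>lborel) + (\<integral>x. (cmod (u x))\<^sup>2 \<partial>lborel)"
  have hu: "integrable lborel (\<lambda>x. h x * u (x + y))" for y
    using integrable_shift[OF u2] by (intro integrable_mult_sq h2) auto
  have hu0: "integrable lborel (\<lambda>x. h x * u x)"
    by (intro integrable_mult_sq h2 u2) auto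
  have bd: "(\<integral>x. cmod (h x * u (x + y)) \<partial>lborel) \<le> J" for y
  proof -
    have "(\<integral>x. cmod (h x * u (x + y)) \<partial>lborel) \<le> (\<integral>x. (cmod (h x))\<^sup>2 + (cmod (u (x + y)))\<^sup>2 \<partial>lborel)"
      by (intro integral_mono integrable_norm hu Bochner_Integration.integrable_add h2
          integrable_shift[OF u2] norm_mult_le_squares)
    also have "\<dots> = (\<integral>x. (cmod (h x))\<^sup>2 \<partial>lborel) + (\<integral>x. (cmod (u (x + y)))\<^sup>2 \<partial>lborel)"
      by (intro Bochner_Integration.integral_add h2 integrable_shift[OF u2])
    also have "(\<integral>x. (cmod (u (x + y)))\<^sup>2 \<partial>lborel) = (\<integral>x. (cmod (u x))\<^sup>2 \<partial>lborel)"
      by (rule integral_shift[of "\<lambda>x. (cmod (u x))\<^sup>2"]) measurable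
    finally show ?thesis by (simp add: J_def)
  qed
  have int: "integrable (lborel \<Otimes>\<^sub>M lborel) (\<lambda>(y, x). complex_of_real (\<rho> y) * (h x * u (x + y)))"
  proof (rule lborel_pair.Fubini_integrable)
    show [measurable]: "(\<lambda>(y, x). complex_of_real (\<rho> y) * (h x * u (x + y))) \<in> borel_measurable (lborel \<Otimes>\<^sub>M lborel)"
      by measurable
    show "integrable lborel (\<lambda>y. \<integral>x. norm (case (y, x) of (y, x) \<Rightarrow> complex_of_real (\<rho> y) * (h x * u (x + y))) \<partial>lborel)"
    proof (rule Bochner_Integration.integrable_bound[OF integrable_mult_right[OF \<rho>i, of J]])
      show "AE y in lborel. norm (\<integral>x. norm (case (y, x) of (y, x) \<Rightarrow> complex_of_real (\<rho> y) * (h x * u (x + y))) \<partial>lborel)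
          \<le> norm (J * \<rho> y)"
      proof (rule AE_I2)
        fix y
        have nn: "0 \<le> (\<integral>x. cmod (h x * u (x + y)) \<partial>lborel)"
          by (rule Bochner_Integration.integral_nonneg) simp
        have "(\<integral>x. norm (complex_of_real (\<rho> y) * (h x * u (x + y))) \<partial>lborel) = \<rho> y * (\<integral>x. cmod (h x * u (x + y)) \<partial>lborel)"
          using \<rho>(2)[of y] by (simp add: norm_mult)
        moreover have "\<dots> \<le> \<rho> y * J" by (intro mult_left_mono bd \<rho>)
        moreover have "0 \<le> \<rho> y * (\<integral>x. cmod (h x * u (x + y)) \<partial>lborel)" using nn \<rho>(2) by simp
        ultimately show "norm (\<integral>x. norm (case (y, x) of (y, x) \<Rightarrow> complex_of_real (\<rho> y) * (h x * u (x + y))) \<partial>lborel)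
          \<le> norm (J * \<rho> y)" by (simp add: mult.commute)
      qed
    qed measurable
    show "AE y in lborel. integrable lborel (\<lambda>x. case (y, x) of (y, x) \<Rightarrow> complex_of_real (\<rho> y) * (h x * u (x + y)))"
      using hu by simp
  qed
  have D: "D y = (\<integral>x. h x * u (x + y) \<partial>lborel) - (\<integral>x. h x * u x \<partial>lborel)" for y
    unfolding D_def right_diff_distrib by (intro Bochner_Integration.integral_diff hu hu0)
  have i1: "integrable lborel (\<lambda>y. complex_of_real (\<rho> y) * (\<integral>x. h x * u (x + y) \<partial>lborel))"
    using lborel_pair.integrable_fst[OF int] by simp
  have i2: "integrable lborel (\<lambda>y. complex_of_real (\<rho> y) * (\<integral>x. h x * u x \<partial>lborel))"
    using \<rho>i by (intro integrable_mult_left integrable_of_real)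
  show "integrable lborel (\<lambda>y. complex_of_real (\<rho> y) * D y)"
    unfolding D right_diff_distrib by (intro Bochner_Integration.integrable_diff i1 i2)
  have "(\<integral>y. u y * complex_of_real (\<rho> (y - x)) \<partial>lborel) = (\<integral>y. complex_of_real (\<rho> y) * u (x + y) \<partial>lborel)" for x
    using integral_shift[of "\<lambda>y. u y * complex_of_real (\<rho> (y - x))" x] by (simp add: mult.commute add.commute)
  then have "(\<integral>x. h x * (\<integral>y. u y * complex_of_real (\<rho> (y - x)) \<partial>lborel) \<partial>lborel)
      = (\<integral>x. (\<integral>y. complex_of_real (\<rho> y) * (h x * u (x + y)) \<partial>lborel) \<partial>lborel)"
    by (simp add: mult.left_commute)
  also have "\<dots> = (\<integral>y. (\<integral>x. complex_of_real (\<rho> y) * (h x * u (x + y)) \<partial>lborel) \<partial>lborel)"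
    by (rule lborel_pair.Fubini_integral[OF int])
  also have "\<dots> = (\<integral>y. complex_of_real (\<rho> y) * (\<integral>x. h x * u (x + y) \<partial>lborel) \<partial>lborel)" by simp
  finally have A: "(\<integral>x. h x * (\<integral>y. u y * complex_of_real (\<rho> (y - x)) \<partial>lborel) \<partial>lborel)
    = (\<integral>y. complex_of_real (\<rho> y) * (\<integral>x. h x * u (x + y) \<partial>lborel) \<partial>lborel)" .
  have "(\<integral>y. complex_of_real (\<rho> y) * (\<integral>x. h x * u x \<partial>lborel) \<partial>lborel)
      = (\<integral>y. complex_of_real (\<rho> y) \<partial>lborel) * (\<integral>x. h x * u x \<partial>lborel)"
    by simp
  also have "(\<integral>y. complex_of_real (\<rho> y) \<partial>lborel) = 1"
    using \<rho>(3) by (simp add: integral_of_real)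
  finally have B: "(\<integral>y. complex_of_real (\<rho> y) * (\<integral>x. h x * u x \<partial>lborel) \<partial>lborel) = (\<integral>x. h x * u x \<partial>lborel)" by simp
  show "(\<integral>x. h x * (\<integral>y. u y * complex_of_real (\<rho> (y - x)) \<partial>lborel) \<partial>lborel) - (\<integral>x. h x * u x \<partial>lborel)
      = (\<integral>y. complex_of_real (\<rho> y) * D y \<partial>lborel)"
    unfolding D right_diff_distrib A
    by (subst Bochner_Integration.integral_diff[OF i1 i2]) (simp only: B)
qed

definition mollifiers :: "(nat \<Rightarrow> real^'n::finite \<Rightarrow> real) \<Rightarrow> bool" where
  "mollifiers \<rho> \<longleftrightarrow> (\<forall>n. test_fun (\<rho> n) \<and> (\<forall>x. \<rho> n x \<ge> 0) \<and>
    (\<forall>x. norm x \<ge> 1 / real (Suc n) \<longrightarrow> \<rho> n x = 0) \<and> integral\<^sup>L lborel (\<rho> n) = 1)"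

lemma exists_mollifiers: "\<exists>\<rho> :: nat \<Rightarrow> real^'n::finite \<Rightarrow> real. mollifiers \<rho>"
  unfolding mollifiers_def
proof (rule choice, rule allI)
  fix n
  have "1 / real (Suc n) > 0" by simp
  then show "\<exists>\<rho> :: real^'n \<Rightarrow> real. test_fun \<rho> \<and> (\<forall>x. \<rho> x \<ge> 0) \<and>
    (\<forall>x. norm x \<ge> 1 / real (Suc n) \<longrightarrow> \<rho> x = 0) \<and> integral\<^sup>L lborel \<rho> = 1"
    by (rule exists_mollifier) blast
qed

lemma mollify_tendsto:
  fixes h u :: "real^'n \<Rightarrow> complex"
  assumes h[measurable]: "h \<in> borel_measurable borel" and h2: "integrable lborel (\<lambda>x. (cmod (h x))\<^sup>2)"
    and supp: "\<forall>x. norm x > R \<longrightarrow> h x = 0"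
    and u: "loc_sq_int u" and \<rho>: "mollifiers \<rho>"
  shows "(\<lambda>n. \<integral>x. h x * (\<integral>y. u y * complex_of_real (\<rho> n (y - x)) \<partial>lborel) \<partial>lborel) \<longlonglongrightarrow> (\<integral>x. h x * u x \<partial>lborel)"
proof -
  \<comment> \<open>Only x with |x| \<le> R matter and every mollifier lives in the unit ball, so
    cutting \<open>u\<close> at radius R + 1 changes nothing and makes it globally square
    integrable.\<close>
  let ?u = "\<lambda>x. indicator (cball 0 (R + 1)) x *\<^sub>R u x"
  define D where "D y = (\<integral>x. h x * (?u (x + y) - ?u x) \<partial>lborel)" for y
  note um = loc_sq_int_truncate(1,2)[OF u, of "R + 1"]
  have \<rho>': "test_fun (\<rho> n)" "\<And>x. \<rho> n x \<ge> 0" "integral\<^sup>L lborel (\<rho> n) = 1" for n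
    using \<rho> by (auto simp: mollifiers_def)
  have \<rho>0: "\<rho> n x = 0" if "norm x \<ge> 1 / real (Suc n)" for n x
    using \<rho> that by (auto simp: mollifiers_def)
  have small: "\<rho> n x = 0" if "norm x > 1" for n x
  proof (rule \<rho>0)
    have "1 / real (Suc n) \<le> 1" by simp
    then show "1 / real (Suc n) \<le> norm x" using that by linarith
  qed
  have hu: "h x * u x = h x * ?u x" for x
    using supp by (cases "norm x > R") (auto simp: indicator_def)
  have hm: "h x * (\<integral>y. u y * complex_of_real (\<rho> n (y - x)) \<partial>lborel)
      = h x * (\<integral>y. ?u y * complex_of_real (\<rho> n (y - x)) \<partial>lborel)" for n x
  proof (cases "norm x > R")
    case False
    have "u y * complex_of_real (\<rho> n (y - x)) = ?u y * complex_of_real (\<rho> n (y - x))" for y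
    proof (cases "norm (y - x) > 1")
      case f: False
      then have "norm y \<le> R + 1" using False norm_triangle_ineq[of "y - x" x] by simp
      then show ?thesis by simp
    qed (simp add: small)
    then show ?thesis by presburger
  qed (simp add: supp)
  have diff: "(\<integral>x. h x * (\<integral>y. u y * complex_of_real (\<rho> n (y - x)) \<partial>lborel) \<partial>lborel) - (\<integral>x. h x * u x \<partial>lborel)
      = (\<integral>y. complex_of_real (\<rho> n y) * D y \<partial>lborel)" for n
    unfolding hm hu D_def using \<rho>' by (intro mollify_diff(2) h um h2)
  have Di: "integrable lborel (\<lambda>y. complex_of_real (\<rho> n y) * D y)" for n
    unfolding D_def using \<rho>' by (intro mollify_diff(1) h um h2)
  show ?thesis
  proof (rule LIM_zero_cancel, unfold diff, rule tendstoI)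
    fix e :: real assume "e > 0"
    \<comment> \<open>Averaging against \<open>\<rho> n\<close> needs \<open>D\<close> to be small
      on a whole ball about 0. Translation continuity is known along sequences only; sequential
      smallness at 0 upgrades to a neighbourhood.\<close>
    have "eventually (\<lambda>y. cmod (D y) < e / 2) (inf (nhds 0) (principal UNIV))"
    proof (rule sequentially_imp_eventually_nhds_within, intro allI impI)
      fix z :: "nat \<Rightarrow> real^'n" assume "(\<forall>n. z n \<in> UNIV) \<and> z \<longlonglongrightarrow> 0"
      then have "(\<lambda>n. D (z n)) \<longlonglongrightarrow> 0"
        unfolding D_def by (intro correlation_tendsto h h2 um) auto
      then show "eventually (\<lambda>n. cmod (D (z n)) < e / 2) sequentially"
        using \<open>e > 0\<close> tendstoD[of "\<lambda>n. D (z n)" 0 sequentially "e / 2"] by simp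
    qed
    then obtain d where d: "d > 0" "\<And>y. norm y < d \<Longrightarrow> cmod (D y) < e / 2"
      by (auto simp: eventually_nhds_metric)
    have "eventually (\<lambda>n. 1 / real (Suc n) < d) sequentially"
      using order_tendstoD(2)[OF LIMSEQ_Suc[OF lim_1_over_n] d(1)] by simp
    then show "eventually (\<lambda>n. dist (\<integral>y. complex_of_real (\<rho> n y) * D y \<partial>lborel) 0 < e) sequentially"
    proof eventually_elim
      case (elim n)
      have "cmod (\<integral>y. complex_of_real (\<rho> n y) * D y \<partial>lborel) \<le> (\<integral>y. cmod (complex_of_real (\<rho> n y) * D y) \<partial>lborel)"
        by (rule integral_norm_bound)
      also have "\<dots> \<le> (\<integral>y. \<rho> n y * (e / 2) \<partial>lborel)"
      proof (rule integral_mono)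
        show "integrable lborel (\<lambda>y. cmod (complex_of_real (\<rho> n y) * D y))"
          by (intro integrable_norm Di)
        show "integrable lborel (\<lambda>y. \<rho> n y * (e / 2))"
          by (intro integrable_mult_left test_fun_integrable \<rho>')
        fix y
        show "cmod (complex_of_real (\<rho> n y) * D y) \<le> \<rho> n y * (e / 2)"
        proof (cases "norm y < d")
          case True
          then have "\<rho> n y * cmod (D y) \<le> \<rho> n y * (e / 2)"
            using d(2)[OF True] \<rho>'(2)[of n y] by (intro mult_left_mono) auto
          then show ?thesis using \<rho>'(2)[of n y] by (simp add: norm_mult)
        next
          case False
          then have "\<rho> n y = 0" using elim by (intro \<rho>0) linarith
          then show ?thesis by simp
        qed
      qed
      also have "\<dots> = e / 2" using \<rho>'(3)[of n] by simp
      also have "\<dots> < e" using \<open>e > 0\<close> by simp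
      finally show ?case by simp
    qed
  qed
qed

lemma integrable_mult_reflected_test_fun:
  fixes h :: "real^'n \<Rightarrow> complex" and K :: "real^'n \<Rightarrow> real"
  assumes h: "integrable lborel h" and K: "test_fun K"
  shows "integrable lborel (\<lambda>x. h x * complex_of_real (K (y - x)))"
proof -
  obtain B where B: "B > 0" "\<And>x. norm (K x) \<le> B" using K by (rule test_fun_bounded) blast
  note [measurable] = test_fun_measurable[OF K] borel_measurable_integrable[OF h]
  show ?thesis
  proof (rule Bochner_Integration.integrable_bound[OF integrable_mult_right[OF integrable_norm[OF h], of B]])
    show "AE x in lborel. norm (h x * complex_of_real (K (y - x))) \<le> norm (B * norm (h x))"
    proof (rule AE_I2)
      fix x
      have "\<bar>K (y - x)\<bar> * cmod (h x) \<le> B * cmod (h x)"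
        using B(2)[of "y - x"] by (intro mult_right_mono) auto
      then show "norm (h x * complex_of_real (K (y - x))) \<le> norm (B * norm (h x))"
        using B(1) by (simp add: norm_mult mult.commute)
    qed
  qed measurable
qed

text \<open>Insert $\rho(y - \cdot)\psi$ as a test function, multiply by
  $v(y)$, integrate over $y$ and exchange the integrals. The derivative then falls on $\rho$ inside the
  $y$-integral, where the weak gradient of $v$ absorbs it, so smoothness of the convolution is
  never needed.\<close>

lemma weak_form_test_sobolev_borel:
  fixes F G :: "'n::finite \<Rightarrow> real^'n \<Rightarrow> complex" and f v :: "real^'n \<Rightarrow> complex" and \<psi> :: "real^'n \<Rightarrow> real"
  assumes F: "\<And>k. loc_sq_int (F k)" and G: "\<And>k. loc_sq_int (G k)" and f: "loc_sq_int f" and v: "loc_sq_int v"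
    and eq: "\<And>\<phi>::real^'n \<Rightarrow> real. test_fun \<phi> \<Longrightarrow>
      (\<integral>x. (\<Sum>k\<in>UNIV. F k x * complex_of_real (pd k \<phi> x)) \<partial>lborel) = (\<integral>x. f x * complex_of_real (\<phi> x) \<partial>lborel)"
    and wk: "\<And>k. \<And>\<phi>::real^'n \<Rightarrow> real. test_fun \<phi> \<Longrightarrow>
      (\<integral>x. v x * complex_of_real (pd k \<phi> x) \<partial>lborel) = - (\<integral>x. G k x * complex_of_real (\<phi> x) \<partial>lborel)"
    and \<psi>: "test_fun \<psi>"
  shows "(\<integral>x. (\<Sum>k\<in>UNIV. F k x * (G k x * complex_of_real (\<psi> x) + v x * complex_of_real (pd k \<psi> x))) \<partial>lborel)
    = (\<integral>x. f x * v x * complex_of_real (\<psi> x) \<partial>lborel)"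
proof -
  obtain R where R: "\<And>x. norm x > R \<Longrightarrow> \<psi> x = 0" using \<psi> by (rule test_funE) blast
  have R': "pd k \<psi> x = 0" if "norm x > R" for k x
    using pd_eq_0_outside[of R \<psi>] R that by blast
  obtain \<rho> :: "nat \<Rightarrow> real^'n \<Rightarrow> real" where \<rho>: "mollifiers \<rho>" using exists_mollifiers by blast
  \<comment> \<open>In \<open>a\<close>, \<open>b\<close> and \<open>c\<close> the cutoff \<psi> or
    its derivative is absorbed into the coefficients, so that every integral over x has a weight
    supported in one ball.\<close>
  define a where "a k x = F k x * complex_of_real (pd k \<psi> x)" for k x
  define b where "b k x = F k x * complex_of_real (\<psi> x)" for k x
  define c where "c x = f x * complex_of_real (\<psi> x)" for x
  have a: "a k \<in> borel_measurable borel" "integrable lborel (\<lambda>x. (cmod (a k x))\<^sup>2)" "integrable lborel (a k)" for k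
    unfolding a_def using loc_sq_int_mult_test_fun[OF F test_fun_pd[OF \<psi>] R'] by auto
  have b: "b k \<in> borel_measurable borel" "integrable lborel (\<lambda>x. (cmod (b k x))\<^sup>2)" "integrable lborel (b k)" for k
    unfolding b_def using loc_sq_int_mult_test_fun[OF F \<psi> R] by auto
  have c: "c \<in> borel_measurable borel" "integrable lborel (\<lambda>x. (cmod (c x))\<^sup>2)" "integrable lborel c"
    unfolding c_def using loc_sq_int_mult_test_fun[OF f \<psi> R] by auto
  have a0: "\<forall>x. norm x > R \<longrightarrow> a k x = 0" and b0: "\<forall>x. norm x > R \<longrightarrow> b k x = 0"
    and c0: "\<forall>x. norm x > R \<longrightarrow> c x = 0" for k
    by (auto simp: a_def b_def c_def R R')
  define m where "m n u x = (\<integral>y. u y * complex_of_real (\<rho> n (y - x)) \<partial>lborel)" for n u and x :: "real^'n"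
  have step: "(\<Sum>k\<in>UNIV. (\<integral>x. a k x * m n v x \<partial>lborel) + (\<integral>x. b k x * m n (G k) x \<partial>lborel))
      = (\<integral>x. c x * m n v x \<partial>lborel)" for n
  proof -
    define r where "r = \<rho> n"
    have r: "test_fun r" using \<rho> by (simp add: mollifiers_def r_def)
    note ra = integrable_mult_reflected_test_fun[OF a(3) r]
      and rb = integrable_mult_reflected_test_fun[OF b(3) test_fun_pd[OF r]]
    have y_eq: "(\<Sum>k\<in>UNIV. (\<integral>x. a k x * complex_of_real (r (y - x)) \<partial>lborel)
        - (\<integral>x. b k x * complex_of_real (pd k r (y - x)) \<partial>lborel))
        = (\<integral>x. c x * complex_of_real (r (y - x)) \<partial>lborel)" for y
    proof -
      let ?\<phi> = "\<lambda>x. r (y + (-1) *\<^sub>R x) * \<psi> x"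
      have sm: "smooth (\<lambda>x. r (y + (-1) *\<^sub>R x))"
        by (rule smooth_affine[OF test_fun_smooth[OF r]])
      have p: "pd k ?\<phi> x = r (y - x) * pd k \<psi> x - pd k r (y - x) * \<psi> x" for k x
        using pd_mult[OF sm test_fun_smooth[OF \<psi>], of k x] pd_affine[OF test_fun_smooth[OF r], of k y "-1" x]
        by simp
      have "F k x * complex_of_real (pd k ?\<phi> x) =
          a k x * complex_of_real (r (y - x)) - b k x * complex_of_real (pd k r (y - x))" for k x
        unfolding p by (simp add: a_def b_def algebra_simps)
      then have "(\<integral>x. (\<Sum>k\<in>UNIV. F k x * complex_of_real (pd k ?\<phi> x)) \<partial>lborel) =
          (\<Sum>k\<in>UNIV. (\<integral>x. a k x * complex_of_real (r (y - x)) \<partial>lborel)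
            - (\<integral>x. b k x * complex_of_real (pd k r (y - x)) \<partial>lborel))"
        using ra rb by (simp add: Bochner_Integration.integral_sum)
      moreover have "(\<integral>x. f x * complex_of_real (?\<phi> x) \<partial>lborel) = (\<integral>x. c x * complex_of_real (r (y - x)) \<partial>lborel)"
        by (simp add: c_def mult_ac)
      ultimately show ?thesis
        using eq[OF test_fun_mult[OF \<psi> sm]] by simp
    qed
    note fa = mollify_Fubini[OF a(3) a0 v r]
      and fb = mollify_Fubini[OF b(3) b0 v test_fun_pd[OF r]]
      and fc = mollify_Fubini[OF c(3) c0 v r]
    \<comment> \<open>The minus sign of the weak gradient cancels the one that \<open>p\<close>
      acquired by differentiating the reflected kernel in x. Both terms of the product rule end up
      with a plus sign.\<close>
    have grad: "(\<integral>y. v y * complex_of_real (pd k r (y - x)) \<partial>lborel) = - m n (G k) x" for k x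
    proof -
      have t: "test_fun (\<lambda>y. r (- x + 1 *\<^sub>R y))" by (rule test_fun_affine[OF r]) simp
      have "pd k (\<lambda>y. r (- x + 1 *\<^sub>R y)) y = pd k r (y - x)" for y
        using pd_affine[OF test_fun_smooth[OF r], of k "- x" 1 y] by simp
      then show ?thesis using wk[OF t, of k] by (simp add: m_def r_def)
    qed
    have "(\<integral>x. c x * m n v x \<partial>lborel) = (\<integral>y. v y * (\<integral>x. c x * complex_of_real (r (y - x)) \<partial>lborel) \<partial>lborel)"
      unfolding fc(2) unfolding m_def r_def ..
    also have "\<dots> = (\<integral>y. (\<Sum>k\<in>UNIV. v y * (\<integral>x. a k x * complex_of_real (r (y - x)) \<partial>lborel)
        - v y * (\<integral>x. b k x * complex_of_real (pd k r (y - x)) \<partial>lborel)) \<partial>lborel)"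
      unfolding y_eq[symmetric] sum_distrib_left right_diff_distrib ..
    also have "\<dots> = (\<Sum>k\<in>UNIV. (\<integral>y. v y * (\<integral>x. a k x * complex_of_real (r (y - x)) \<partial>lborel) \<partial>lborel)
        - (\<integral>y. v y * (\<integral>x. b k x * complex_of_real (pd k r (y - x)) \<partial>lborel) \<partial>lborel))"
      using fa(1) fb(1)
      by (subst Bochner_Integration.integral_sum) (auto intro!: sum.cong Bochner_Integration.integral_diff)
    also have "\<dots> = (\<Sum>k\<in>UNIV. (\<integral>x. a k x * m n v x \<partial>lborel) + (\<integral>x. b k x * m n (G k) x \<partial>lborel))"
      unfolding fa(2) fb(2) grad by (simp add: m_def r_def)
    finally show ?thesis ..
  qed
  have "(\<lambda>n. \<Sum>k\<in>UNIV. (\<integral>x. a k x * m n v x \<partial>lborel) + (\<integral>x. b k x * m n (G k) x \<partial>lborel)) \<longlonglongrightarrow>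
      (\<Sum>k\<in>UNIV. (\<integral>x. a k x * v x \<partial>lborel) + (\<integral>x. b k x * G k x \<partial>lborel))"
    unfolding m_def
    by (intro tendsto_sum tendsto_add mollify_tendsto[OF a(1,2) a0 v \<rho>] mollify_tendsto[OF b(1,2) b0 G \<rho>])
  moreover have "(\<lambda>n. \<integral>x. c x * m n v x \<partial>lborel) \<longlonglongrightarrow> (\<integral>x. c x * v x \<partial>lborel)"
    unfolding m_def by (rule mollify_tendsto[OF c(1,2) c0 v \<rho>])
  ultimately have lim: "(\<Sum>k\<in>UNIV. (\<integral>x. a k x * v x \<partial>lborel) + (\<integral>x. b k x * G k x \<partial>lborel)) = (\<integral>x. c x * v x \<partial>lborel)"
    unfolding step by (rule LIMSEQ_unique)
  \<comment> \<open>\<open>v\<close> and \<open>G k\<close> are only locally square integrable.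
    Cutting them to the ball that carries \<open>a k\<close> and \<open>b k\<close> leaves the
    products unchanged and makes all factors globally square integrable.\<close>
  have trunc: "h x * u x = h x * (indicator (cball 0 R) x *\<^sub>R u x)"
    if "\<forall>x. norm x > R \<longrightarrow> h x = 0" for h u :: "real^'n \<Rightarrow> complex" and x
    using that by (cases "norm x > R") auto
  have i: "integrable lborel (\<lambda>x. a k x * v x)" "integrable lborel (\<lambda>x. b k x * G k x)" for k
    unfolding trunc[of "a k", OF a0] trunc[of "b k", OF b0]
    by (intro integrable_mult_sq;
        use a(1,2) b(1,2) loc_sq_int_truncate(1,2)[OF v] loc_sq_int_truncate(1,2)[OF G] in \<open>simp only: measurable_lborel2\<close>)+
  have "F k x * (G k x * complex_of_real (\<psi> x) + v x * complex_of_real (pd k \<psi> x)) = a k x * v x + b k x * G k x" for k x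
    by (simp add: a_def b_def algebra_simps)
  then have "(\<integral>x. (\<Sum>k\<in>UNIV. F k x * (G k x * complex_of_real (\<psi> x) + v x * complex_of_real (pd k \<psi> x))) \<partial>lborel)
      = (\<Sum>k\<in>UNIV. (\<integral>x. a k x * v x \<partial>lborel) + (\<integral>x. b k x * G k x \<partial>lborel))"
    using i by (simp add: Bochner_Integration.integral_sum)
  also have "\<dots> = (\<integral>x. f x * v x * complex_of_real (\<psi> x) \<partial>lborel)"
    unfolding lim by (simp add: c_def mult_ac)
  finally show ?thesis .
qed

section \<open>Locally square integrable functions\<close>

lemma borel_measurable_lebesgueI: "f \<in> borel_measurable borel \<Longrightarrow> f \<in> borel_measurable lebesgue"
  by (rule measurable_completion) simp

lemma ball_lebesgue: "ball c r \<in> sets lebesgue" "cball c r \<in> sets lebesgue"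
  for c :: "'a::euclidean_space"
  by auto

lemma borel_measurable_cnj:
  "f \<in> borel_measurable M \<Longrightarrow> (\<lambda>x. cnj (f x)) \<in> borel_measurable M"
  by (rule borel_measurable_continuous_on[of cnj]) (intro continuous_intros)

lemma borel_measurable_complex_of_real:
  "f \<in> borel_measurable M \<Longrightarrow> (\<lambda>x. complex_of_real (f x)) \<in> borel_measurable M"
  by (rule borel_measurable_continuous_on[of complex_of_real]) (intro continuous_intros)

lemmas complex_measurable_intros = borel_measurable_sum borel_measurable_times borel_measurable_add
  borel_measurable_cnj borel_measurable_complex_of_real

text \<open>The passage from the completed measure to Borel functions is available for real
  functions, so real and imaginary parts are treated separately.\<close>

lemma lebesgue_measurable_borel_rep:
  fixes u :: "'a::euclidean_space \<Rightarrow> complex"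
  assumes "u \<in> borel_measurable lebesgue"
  shows "\<exists>u'\<in>borel_measurable borel. AE x in lebesgue. u x = u' x"
proof -
  have "(\<lambda>x. Re (u x)) \<in> borel_measurable lebesgue" "(\<lambda>x. Im (u x)) \<in> borel_measurable lebesgue"
    using assms by measurable
  then obtain a b where [measurable]: "a \<in> borel_measurable lborel" "b \<in> borel_measurable lborel"
    and ae: "AE x in lborel. Re (u x) = a x" "AE x in lborel. Im (u x) = b x"
    using completion_ex_borel_measurable_real[of "\<lambda>x. Re (u x)" lborel]
      completion_ex_borel_measurable_real[of "\<lambda>x. Im (u x)" lborel] by auto
  have "AE x in lborel. u x = Complex (a x) (b x)"
    using ae by eventually_elim (simp add: complex_eq_iff)
  moreover have "(\<lambda>x. complex_of_real (a x) + \<i> * complex_of_real (b x)) \<in> borel_measurable lborel"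
    by measurable
  ultimately show ?thesis
    by (intro bexI[of _ "\<lambda>x. Complex (a x) (b x)"]) (auto simp: Complex_eq intro: AE_completion)
qed

lemma lebesgue_integral_eq_lborel:
  fixes f f' :: "'a::euclidean_space \<Rightarrow> complex"
  assumes "f \<in> borel_measurable lebesgue" "f' \<in> borel_measurable borel" "AE x in lebesgue. f x = f' x"
  shows "integral\<^sup>L lebesgue f = integral\<^sup>L lborel f'"
proof -
  have "integral\<^sup>L lebesgue f = integral\<^sup>L lebesgue f'"
    by (rule integral_cong_AE[OF assms(1) borel_measurable_lebesgueI[OF assms(2)] assms(3)])
  also have "\<dots> = integral\<^sup>L lborel f'" using assms(2) by (intro integral_completion) simp
  finally show ?thesis .
qed

section \<open>Closure properties of local square integrability\<close>

lemma loc_L2_measurable: "loc_L2 u \<Longrightarrow> u \<in> borel_measurable lebesgue"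
  by (simp add: loc_L2_def)

lemma loc_L2_integrable:
  "loc_L2 u \<Longrightarrow> compact K \<Longrightarrow> integrable lebesgue (\<lambda>x. indicator K x * (norm (u x))\<^sup>2)"
  by (simp add: loc_L2_def set_integrable_def)

lemma loc_L2I:
  assumes "u \<in> borel_measurable lebesgue"
    and "\<And>R. integrable lebesgue (\<lambda>x. indicator (cball 0 R) x * (norm (u x))\<^sup>2)"
  shows "loc_L2 u"
  unfolding loc_L2_def set_integrable_def
proof (intro conjI allI impI assms(1))
  fix K :: "(real^'a) set" assume "compact K"
  then obtain R where R: "K \<subseteq> cball 0 R"
    using bounded_subset_ballD[OF compact_imp_bounded, of K 0] by (meson ball_subset_cball order_trans)
  have [measurable]: "K \<in> sets lebesgue" using \<open>compact K\<close> by (simp add: borel_compact)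
  note [measurable] = assms(1)
  show "integrable lebesgue (\<lambda>x. indicat_real K x *\<^sub>R (norm (u x))\<^sup>2)"
    by (rule Bochner_Integration.integrable_bound[OF assms(2)[of R]])
      (use R in \<open>auto simp: indicator_def intro!: AE_I2\<close>)
qed

text \<open>The constant may depend on the radius. This admits unbounded multipliers such as the
  coordinates in the drift term x \<cdot> \<nabla>w.\<close>

lemma loc_L2_bound:
  fixes u :: "real^'n \<Rightarrow> 'b::{banach,second_countable_topology}"
    and v :: "real^'n \<Rightarrow> 'c::{banach,second_countable_topology}"
  assumes v: "loc_L2 v" and [measurable]: "u \<in> borel_measurable lebesgue"
    and le: "\<And>R x. norm x \<le> R \<Longrightarrow> norm (u x) \<le> C R * norm (v x)"
  shows "loc_L2 u"
proof (rule loc_L2I)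
  fix R
  show "integrable lebesgue (\<lambda>x. indicator (cball 0 R) x * (norm (u x))\<^sup>2)"
  proof (rule Bochner_Integration.integrable_bound[OF integrable_mult_right[OF loc_L2_integrable[OF v compact_cball]]])
    show "AE x in lebesgue. norm (indicator (cball 0 R) x * (norm (u x))\<^sup>2) \<le>
        norm ((C R)\<^sup>2 * (indicator (cball 0 R) x * (norm (v x))\<^sup>2))"
    proof (rule AE_I2)
      fix x
      show "norm (indicator (cball 0 R) x * (norm (u x))\<^sup>2) \<le>
        norm ((C R)\<^sup>2 * (indicator (cball 0 R) x * (norm (v x))\<^sup>2))"
        using power_mono[OF le[of x R] norm_ge_zero, of 2] by (auto simp: indicator_def power_mult_distrib)
    qed
  qed (use ball_lebesgue in measurable)
qed (rule assms)

lemma loc_L2_add: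
  assumes "loc_L2 u" "loc_L2 v"
  shows "loc_L2 (\<lambda>x. u x + v x)"
proof (rule loc_L2I)
  note [measurable] = loc_L2_measurable[OF assms(1)] loc_L2_measurable[OF assms(2)]
  show "(\<lambda>x. u x + v x) \<in> borel_measurable lebesgue" by measurable
  fix R
  show "integrable lebesgue (\<lambda>x. indicator (cball 0 R) x * (norm (u x + v x))\<^sup>2)"
  proof (rule Bochner_Integration.integrable_bound)
    show "integrable lebesgue (\<lambda>x. 2 * (indicator (cball 0 R) x * (norm (u x))\<^sup>2) + 2 * (indicator (cball 0 R) x * (norm (v x))\<^sup>2))"
      by (intro Bochner_Integration.integrable_add integrable_mult_right loc_L2_integrable assms compact_cball)
    show "AE x in lebesgue. norm (indicator (cball 0 R) x * (norm (u x + v x))\<^sup>2) \<le>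
       norm (2 * (indicator (cball 0 R) x * (norm (u x))\<^sup>2) + 2 * (indicator (cball 0 R) x * (norm (v x))\<^sup>2))"
    proof (rule AE_I2)
      fix x
      have "(norm (u x + v x))\<^sup>2 \<le> (norm (u x) + norm (v x))\<^sup>2"
        by (intro power_mono norm_triangle_ineq) simp
      also have "\<dots> \<le> 2 * (norm (u x))\<^sup>2 + 2 * (norm (v x))\<^sup>2"
        using mult_le_half_squares[of "norm (u x)" "norm (v x)"] by (simp add: power2_sum)
      finally show "norm (indicator (cball 0 R) x * (norm (u x + v x))\<^sup>2) \<le>
       norm (2 * (indicator (cball 0 R) x * (norm (u x))\<^sup>2) + 2 * (indicator (cball 0 R) x * (norm (v x))\<^sup>2))"
        by (auto simp: indicator_def)
    qed
  qed (use ball_lebesgue in measurable)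
qed

lemma loc_L2_zero: "loc_L2 (\<lambda>x. 0)"
  by (rule loc_L2I) auto

lemma loc_L2_sum: "(\<And>k. k \<in> I \<Longrightarrow> loc_L2 (u k)) \<Longrightarrow> loc_L2 (\<lambda>x. \<Sum>k\<in>I. u k x)"
  by (induction I rule: infinite_finite_induct) (simp_all add: loc_L2_zero loc_L2_add)

lemma loc_L2_mult_continuous:
  fixes u c :: "real^'n \<Rightarrow> complex"
  assumes u: "loc_L2 u" and c: "continuous_on UNIV c"
  shows "loc_L2 (\<lambda>x. c x * u x)"
proof -
  have "\<exists>B. \<forall>x. norm x \<le> R \<longrightarrow> norm (c x) \<le> B" for R
  proof -
    have "compact (c ` cball 0 R)"
      using c by (intro compact_continuous_image) (auto intro: continuous_on_subset)
    then show ?thesis using compact_imp_bounded bounded_iff by (metis imageI mem_cball_0)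
  qed
  then obtain B where B: "\<And>R x. norm x \<le> R \<Longrightarrow> norm (c x) \<le> B R" by metis
  note [measurable] = loc_L2_measurable[OF u] borel_measurable_lebesgueI[OF borel_measurable_continuous_onI[OF c]]
  show ?thesis
    by (rule loc_L2_bound[OF u, of _ B]) (auto simp: norm_mult intro: mult_right_mono B)
qed

lemma loc_L2_cmult: "loc_L2 u \<Longrightarrow> loc_L2 (\<lambda>x. c * u x)" for u :: "_ \<Rightarrow> complex"
  by (rule loc_L2_mult_continuous) auto

lemma borel_measurable_vec_nth:
  fixes f :: "'a \<Rightarrow> 'b::euclidean_space ^ 'n"
  assumes "f \<in> borel_measurable M"
  shows "(\<lambda>x. f x $ k) \<in> borel_measurable M"
  using assms by (rule borel_measurable_continuous_on[rotated]) (intro continuous_intros)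

lemma loc_L2_vec_nth:
  fixes g :: "real^'n \<Rightarrow> complex^'m"
  assumes "loc_L2 g"
  shows "loc_L2 (\<lambda>x. g x $ k)"
  by (rule loc_L2_bound[OF assms, of _ "\<lambda>_. 1"])
    (auto intro: borel_measurable_vec_nth loc_L2_measurable assms Finite_Cartesian_Product.norm_nth_le)

lemma loc_sq_int_rep:
  fixes u :: "real^'n \<Rightarrow> complex"
  assumes "loc_L2 u"
  shows "\<exists>u'. loc_sq_int u' \<and> (AE x in lebesgue. u x = u' x)"
proof -
  obtain u' where u'[measurable]: "u' \<in> borel_measurable borel" and ae: "AE x in lebesgue. u x = u' x"
    using lebesgue_measurable_borel_rep[OF loc_L2_measurable[OF assms]] by blast
  have m: "(\<lambda>x. indicat_real (cball 0 R) x * (cmod (u' x))\<^sup>2) \<in> borel_measurable lborel" for R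
    using u' by (auto intro!: borel_measurable_times borel_measurable_indicator borel_measurable_power borel_measurable_norm)
  have mL: "(\<lambda>x. indicat_real (cball 0 R) x * (cmod (u x))\<^sup>2) \<in> borel_measurable lebesgue" for R
    using loc_L2_integrable[OF assms compact_cball, of 0 R] by (rule borel_measurable_integrable)
  have "integrable lborel (\<lambda>x. indicator (cball 0 R) x * (cmod (u' x))\<^sup>2)" for R
  proof -
    have "AE x in lebesgue. indicat_real (cball 0 R) x * (cmod (u x))\<^sup>2 = indicat_real (cball 0 R) x * (cmod (u' x))\<^sup>2"
      using ae by eventually_elim simp
    then have "integrable lebesgue (\<lambda>x. indicat_real (cball 0 R) x * (cmod (u x))\<^sup>2) =
        integrable lebesgue (\<lambda>x. indicat_real (cball 0 R) x * (cmod (u' x))\<^sup>2)"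
      by (intro integrable_cong_AE mL measurable_completion[OF m])
    then have "integrable lebesgue (\<lambda>x. indicat_real (cball 0 R) x * (cmod (u' x))\<^sup>2)"
      using loc_L2_integrable[OF assms compact_cball, of 0 R] by blast
    then show ?thesis
      by (rule integrable_completion[THEN iffD1, OF m])
  qed
  then show ?thesis using u' ae unfolding loc_sq_int_def by (intro exI[of _ u'] conjI allI)
qed

text \<open>The preceding version is bilinear; here it is applied to the conjugate of
  \<open>w\<close>. Since the test functions are real, conjugating the weak derivative identity
  shows that the conjugate of \<open>w\<close> has weak gradient \<open>cnj (G k)\<close>. The rest
  replaces every function by a Borel representative.\<close>

lemma weak_form_test_sobolev:
  fixes F G :: "'n::finite \<Rightarrow> real^'n \<Rightarrow> complex" and f w :: "real^'n \<Rightarrow> complex" and \<psi> :: "real^'n \<Rightarrow> real"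
  assumes F: "\<And>k. loc_L2 (F k)" and G: "\<And>k. loc_L2 (G k)" and f: "loc_L2 f" and w: "loc_L2 w"
    and eq: "\<And>\<phi>::real^'n \<Rightarrow> real. test_fun \<phi> \<Longrightarrow>
      (\<integral>x. (\<Sum>k\<in>UNIV. F k x * complex_of_real (pd k \<phi> x)) \<partial>lebesgue) = (\<integral>x. f x * complex_of_real (\<phi> x) \<partial>lebesgue)"
    and wk: "\<And>k. \<And>\<phi>::real^'n \<Rightarrow> real. test_fun \<phi> \<Longrightarrow>
      (\<integral>x. w x * complex_of_real (pd k \<phi> x) \<partial>lebesgue) = - (\<integral>x. G k x * complex_of_real (\<phi> x) \<partial>lebesgue)"
    and \<psi>: "test_fun \<psi>"
  shows "(\<integral>x. (\<Sum>k\<in>UNIV. F k x * (cnj (G k x) * complex_of_real (\<psi> x) + cnj (w x) * complex_of_real (pd k \<psi> x))) \<partial>lebesgue)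
    = (\<integral>x. f x * cnj (w x) * complex_of_real (\<psi> x) \<partial>lebesgue)"
proof -
  have "\<exists>F'. \<forall>k. loc_sq_int (F' k) \<and> (AE x in lebesgue. F k x = F' k x)"
    by (rule choice) (use loc_sq_int_rep[OF F] in blast)
  then obtain F' where F': "\<And>k. loc_sq_int (F' k)" "\<And>k. AE x in lebesgue. F k x = F' k x" by blast
  have "\<exists>G'. \<forall>k. loc_sq_int (G' k) \<and> (AE x in lebesgue. G k x = G' k x)"
    by (rule choice) (use loc_sq_int_rep[OF G] in blast)
  then obtain G' where G': "\<And>k. loc_sq_int (G' k)" "\<And>k. AE x in lebesgue. G k x = G' k x" by blast
  obtain f' where f': "loc_sq_int f'" "AE x in lebesgue. f x = f' x" using loc_sq_int_rep[OF f] by blast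
  obtain w' where w': "loc_sq_int w'" "AE x in lebesgue. w x = w' x" using loc_sq_int_rep[OF w] by blast
  have AF: "AE x in lebesgue. \<forall>k. F k x = F' k x" and AG: "AE x in lebesgue. \<forall>k. G k x = G' k x"
    using F'(2) G'(2) by (simp_all add: AE_all_countable)
  have meas': "F' k \<in> borel_measurable borel" "G' k \<in> borel_measurable borel"
    "f' \<in> borel_measurable borel" "w' \<in> borel_measurable borel" for k
    using F' G' f' w' by (auto simp: loc_sq_int_def)
  note meas = loc_L2_measurable[OF F] loc_L2_measurable[OF G] loc_L2_measurable[OF f] loc_L2_measurable[OF w]
  have cnj_L2: "loc_sq_int (\<lambda>x. cnj (u x))" if "loc_sq_int u" for u :: "real^'n \<Rightarrow> complex"
    using that by (auto simp: loc_sq_int_def intro: borel_measurable_cnj)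
  have tm: "\<phi> \<in> borel_measurable borel" "\<phi> \<in> borel_measurable lebesgue"
    "pd k \<phi> \<in> borel_measurable borel" "pd k \<phi> \<in> borel_measurable lebesgue"
    if "test_fun \<phi>" for \<phi> :: "real^'n \<Rightarrow> real" and k
    using test_fun_measurable[OF that] test_fun_measurable[OF test_fun_pd[OF that]]
    by (auto intro: borel_measurable_lebesgueI)
  have eq': "(\<integral>x. (\<Sum>k\<in>UNIV. F' k x * complex_of_real (pd k \<phi> x)) \<partial>lborel) = (\<integral>x. f' x * complex_of_real (\<phi> x) \<partial>lborel)"
    if \<phi>: "test_fun \<phi>" for \<phi> :: "real^'n \<Rightarrow> real"
  proof -
    note t = tm[OF \<phi>]
    have "(\<integral>x. (\<Sum>k\<in>UNIV. F k x * complex_of_real (pd k \<phi> x)) \<partial>lebesgue) = (\<integral>x. (\<Sum>k\<in>UNIV. F' k x * complex_of_real (pd k \<phi> x)) \<partial>lborel)"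
      by (rule lebesgue_integral_eq_lborel, (intro complex_measurable_intros meas meas' t)+) (use AF in \<open>eventually_elim, simp\<close>)
    moreover have "(\<integral>x. f x * complex_of_real (\<phi> x) \<partial>lebesgue) = (\<integral>x. f' x * complex_of_real (\<phi> x) \<partial>lborel)"
      by (rule lebesgue_integral_eq_lborel, (intro complex_measurable_intros meas meas' t)+) (use f'(2) in \<open>eventually_elim, simp\<close>)
    ultimately show ?thesis using eq[OF \<phi>] by simp
  qed
  have wk': "(\<integral>x. cnj (w' x) * complex_of_real (pd k \<phi> x) \<partial>lborel) = - (\<integral>x. cnj (G' k x) * complex_of_real (\<phi> x) \<partial>lborel)"
    if \<phi>: "test_fun \<phi>" for k and \<phi> :: "real^'n \<Rightarrow> real"
  proof -
    note t = tm[OF \<phi>]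
    have 1: "(\<integral>x. w x * complex_of_real (pd k \<phi> x) \<partial>lebesgue) = (\<integral>x. w' x * complex_of_real (pd k \<phi> x) \<partial>lborel)"
      by (rule lebesgue_integral_eq_lborel, (intro complex_measurable_intros meas meas' t)+) (use w'(2) in \<open>eventually_elim, simp\<close>)
    have 2: "(\<integral>x. G k x * complex_of_real (\<phi> x) \<partial>lebesgue) = (\<integral>x. G' k x * complex_of_real (\<phi> x) \<partial>lborel)"
      by (rule lebesgue_integral_eq_lborel, (intro complex_measurable_intros meas meas' t)+) (use AG in \<open>eventually_elim, simp\<close>)
    have "(\<integral>x. cnj (w' x) * complex_of_real (pd k \<phi> x) \<partial>lborel) = cnj (\<integral>x. w' x * complex_of_real (pd k \<phi> x) \<partial>lborel)"
      using Bochner_Integration.integral_cnj[of lborel "\<lambda>x. w' x * complex_of_real (pd k \<phi> x)"] by simp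
    also have "\<dots> = cnj (- (\<integral>x. G' k x * complex_of_real (\<phi> x) \<partial>lborel))"
      using wk[OF \<phi>, of k] 1 2 by simp
    also have "\<dots> = - (\<integral>x. cnj (G' k x) * complex_of_real (\<phi> x) \<partial>lborel)"
      using Bochner_Integration.integral_cnj[of lborel "\<lambda>x. G' k x * complex_of_real (\<phi> x)"] by simp
    finally show ?thesis .
  qed
  note t = tm[OF \<psi>]
  have "(\<integral>x. (\<Sum>k\<in>UNIV. F k x * (cnj (G k x) * complex_of_real (\<psi> x) + cnj (w x) * complex_of_real (pd k \<psi> x))) \<partial>lebesgue)
    = (\<integral>x. (\<Sum>k\<in>UNIV. F' k x * (cnj (G' k x) * complex_of_real (\<psi> x) + cnj (w' x) * complex_of_real (pd k \<psi> x))) \<partial>lborel)"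
    by (rule lebesgue_integral_eq_lborel, (intro complex_measurable_intros meas meas' t)+) (use AF AG w'(2) in \<open>eventually_elim, simp\<close>)
  also have "\<dots> = (\<integral>x. f' x * cnj (w' x) * complex_of_real (\<psi> x) \<partial>lborel)"
    by (rule weak_form_test_sobolev_borel[OF F'(1) cnj_L2[OF G'(1)] f'(1) cnj_L2[OF w'(1)] eq' wk' \<psi>])
  also have "\<dots> = (\<integral>x. f x * cnj (w x) * complex_of_real (\<psi> x) \<partial>lebesgue)"
    by (rule lebesgue_integral_eq_lborel[symmetric], (intro complex_measurable_intros meas meas' t)+) (use f'(2) w'(2) in \<open>eventually_elim, simp\<close>)
  finally show ?thesis .
qed

lemma loc_L2_mult_integrable:
  fixes u v :: "real^'n \<Rightarrow> complex" and \<psi> :: "real^'n \<Rightarrow> real"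
  assumes u: "loc_L2 u" and v: "loc_L2 v" and \<psi>: "test_fun \<psi>"
  shows "integrable lebesgue (\<lambda>x. u x * v x * complex_of_real (\<psi> x))"
proof -
  obtain R where R: "\<And>x. norm x > R \<Longrightarrow> \<psi> x = 0" using \<psi> by (rule test_funE) blast
  obtain B where B: "B > 0" "\<And>x. norm (\<psi> x) \<le> B" using \<psi> by (rule test_fun_bounded) blast
  note [measurable] = loc_L2_measurable[OF u] loc_L2_measurable[OF v] borel_measurable_lebesgueI[OF test_fun_measurable[OF \<psi>]]
  show ?thesis
  proof (rule Bochner_Integration.integrable_bound)
    show "integrable lebesgue (\<lambda>x. B * (indicator (cball 0 R) x * (cmod (u x))\<^sup>2 + indicator (cball 0 R) x * (cmod (v x))\<^sup>2))"
      by (intro integrable_mult_right Bochner_Integration.integrable_add loc_L2_integrable u v compact_cball)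
    show "AE x in lebesgue. norm (u x * v x * complex_of_real (\<psi> x)) \<le>
        norm (B * (indicator (cball 0 R) x * (cmod (u x))\<^sup>2 + indicator (cball 0 R) x * (cmod (v x))\<^sup>2))"
    proof (rule AE_I2)
      fix x
      show "norm (u x * v x * complex_of_real (\<psi> x)) \<le>
        norm (B * (indicator (cball 0 R) x * (cmod (u x))\<^sup>2 + indicator (cball 0 R) x * (cmod (v x))\<^sup>2))"
      proof (cases "norm x > R")
        case False
        have "norm (u x * v x) * \<bar>\<psi> x\<bar> \<le> ((cmod (u x))\<^sup>2 + (cmod (v x))\<^sup>2) * B"
          using B(2)[of x] by (intro mult_mono norm_mult_le_squares) auto
        then show ?thesis using False B(1) by (simp add: norm_mult mult.commute abs_mult)
      qed (simp add: R)
    qed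
  qed (use ball_lebesgue in measurable)
qed

section \<open>The energy inequality\<close>

lemma loc_L2_cnj: "loc_L2 u \<Longrightarrow> loc_L2 (\<lambda>x. cnj (u x))"
  by (rule loc_L2_bound[of u _ "\<lambda>_. 1"]) (auto intro: borel_measurable_cnj loc_L2_measurable)

text \<open>Taking this function for both factors in the complex statement
  \<open>loc_L2_mult_integrable\<close> gives integrability of |u|^2 \<psi>, also for vector-valued
  \<open>u\<close>.\<close>

lemma loc_L2_norm: "loc_L2 u \<Longrightarrow> loc_L2 (\<lambda>x. complex_of_real (norm (u x)))"
  by (rule loc_L2_bound[of u _ "\<lambda>_. 1"])
    (simp_all add: borel_measurable_complex_of_real measurable_compose[OF loc_L2_measurable borel_measurable_norm])

lemma norm_cnj_vec: "norm (\<chi> k. cnj (p $ k)) = norm p" for p :: "complex^'n"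
  by (simp add: norm_vec_def)

lemma test_fun_square: "test_fun \<eta> \<Longrightarrow> test_fun (\<lambda>x. \<eta> x * \<eta> x)" for \<eta> :: "_ \<Rightarrow> real"
  by (rule test_fun_mult[OF _ test_fun_smooth])

text \<open>In \<open>mono\<close> the operator x \<cdot> \<nabla> has been moved onto the test
  function, so that its formal adjoint -(n + x \<cdot> \<nabla>) appears. The decay of
  \<open>w\<close> and the lower bound on \<mu> stay outside the locale: they enter once, through
  \<open>annulus_mass_le\<close>.\<close>

locale self_similar_profile =
  fixes A :: "real^'n::finite \<Rightarrow> complex^'n^'n"
    and w :: "real^'n \<Rightarrow> complex"
    and g :: "real^'n \<Rightarrow> complex^'n"
    and \<mu> lam Lam :: real
  assumes A_meas: "A \<in> borel_measurable lebesgue"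
    and lam_pos: "lam > 0" and Lam_pos: "Lam > 0"
    and ellip: "\<forall>x p. Re (\<Sum>k\<in>UNIV. \<Sum>l\<in>UNIV. A x $ k $ l * p $ k * cnj (p $ l)) \<ge> lam * (norm p)\<^sup>2"
    and bound: "\<forall>x p. (norm (A x *v p))\<^sup>2 \<le> Lam\<^sup>2 * (norm p)\<^sup>2"
    and H1: "H1_loc w g"
    and eqn: "\<forall>\<phi>::real^'n \<Rightarrow> complex. test_fun \<phi> \<longrightarrow>
       integral\<^sup>L lebesgue (\<lambda>x. \<Sum>k\<in>UNIV. (\<Sum>l\<in>UNIV. A x $ k $ l * g x $ l) * pd k \<phi> x)
       = - integral\<^sup>L lebesgue (\<lambda>x. (1/2) * (\<i> * w x + complex_of_real \<mu> * w x
              + (\<Sum>k\<in>UNIV. complex_of_real (x $ k) * g x $ k)) * \<phi> x)"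
    and mono: "\<forall>\<phi>::real^'n \<Rightarrow> real. test_fun \<phi> \<and> (\<forall>x. \<phi> x \<ge> 0) \<longrightarrow>
       integral\<^sup>L lebesgue (\<lambda>x. 2 * \<mu> * (cmod (w x))\<^sup>2 * \<phi> x
          - (cmod (w x))\<^sup>2 * (real CARD('n) * \<phi> x + (\<Sum>k\<in>UNIV. x $ k * pd k \<phi> x))) \<ge> 0"
begin

definition flux :: "'n \<Rightarrow> real^'n \<Rightarrow> complex" where
  "flux k x = (\<Sum>l\<in>UNIV. A x $ k $ l * g x $ l)"

text \<open>The sign comes from integrating the divergence by parts: the equation now pairs
  \<open>flux\<close> with the gradient of the test function on one side and \<open>rhs\<close> with
  the test function on the other.\<close>

definition rhs :: "real^'n \<Rightarrow> complex" where
  "rhs x = - (1/2) * (\<i> * w x + complex_of_real \<mu> * w x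
     + (\<Sum>k\<in>UNIV. complex_of_real (x $ k) * g x $ k))"

lemma w_L2: "loc_L2 w" and g_L2: "loc_L2 g" and g_nth_L2: "loc_L2 (\<lambda>x. g x $ k)"
  using H1 loc_L2_vec_nth by (auto simp: H1_loc_def)

lemma flux_le: "cmod (flux k x) \<le> Lam * norm (g x)"
proof -
  have "flux k x = (A x *v g x) $ k" by (simp add: flux_def matrix_vector_mult_def)
  then have "cmod (flux k x) \<le> norm (A x *v g x)" using Finite_Cartesian_Product.norm_nth_le by metis
  also have "\<dots> \<le> Lam * norm (g x)"
  proof (rule power2_le_imp_le)
    show "(norm (A x *v g x))\<^sup>2 \<le> (Lam * norm (g x))\<^sup>2"
      using bound by (simp add: power_mult_distrib)
  qed (use Lam_pos in simp)
  finally show ?thesis .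
qed

lemma flux_L2: "loc_L2 (flux k)"
proof (rule loc_L2_bound[OF g_L2, of _ "\<lambda>_. Lam"])
  show "flux k \<in> borel_measurable lebesgue"
    unfolding flux_def
    by (intro borel_measurable_sum borel_measurable_times borel_measurable_vec_nth A_meas
        loc_L2_measurable[OF g_L2])
qed (rule flux_le)

lemma rhs_L2: "loc_L2 rhs"
  unfolding rhs_def
  by (intro loc_L2_cmult loc_L2_add loc_L2_sum w_L2 loc_L2_mult_continuous g_nth_L2) (intro continuous_intros)

lemma weak_equation:
  fixes \<phi> :: "real^'n \<Rightarrow> real"
  assumes "test_fun \<phi>"
  shows "(\<integral>x. (\<Sum>k\<in>UNIV. flux k x * complex_of_real (pd k \<phi> x)) \<partial>lebesgue) = (\<integral>x. rhs x * complex_of_real (\<phi> x) \<partial>lebesgue)"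
proof -
  have "(\<integral>x. rhs x * complex_of_real (\<phi> x) \<partial>lebesgue) = - (\<integral>x. - (rhs x * complex_of_real (\<phi> x)) \<partial>lebesgue)"
    by simp
  then show ?thesis
    using eqn[rule_format, OF test_fun_of_real[OF assms]]
    by (simp add: pd_of_real[OF test_fun_smooth[OF assms]] flux_def rhs_def)
qed

lemma weak_derivative:
  fixes \<phi> :: "real^'n \<Rightarrow> real"
  assumes "test_fun \<phi>"
  shows "(\<integral>x. w x * complex_of_real (pd k \<phi> x) \<partial>lebesgue) = - (\<integral>x. g x $ k * complex_of_real (\<phi> x) \<partial>lebesgue)"
  using H1[unfolded H1_loc_def weak_gradient_def, THEN conjunct2, THEN conjunct2, rule_format,
      OF test_fun_of_real[OF assms], of k]
  by (simp add: pd_of_real[OF test_fun_smooth[OF assms]])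

lemma integrable_norm_mult:
  fixes \<psi> :: "real^'n \<Rightarrow> real"
  assumes "test_fun \<psi>"
  shows "integrable lebesgue (\<lambda>x. (cmod (w x))\<^sup>2 * \<psi> x)" "integrable lebesgue (\<lambda>x. (norm (g x))\<^sup>2 * \<psi> x)"
  using integrable_Re[OF loc_L2_mult_integrable[OF loc_L2_norm[OF w_L2] loc_L2_norm[OF w_L2] assms]]
    integrable_Re[OF loc_L2_mult_integrable[OF loc_L2_norm[OF g_L2] loc_L2_norm[OF g_L2] assms]]
  by (simp_all add: power2_eq_square)

text \<open>The weak form of $2\,\mathrm{Re}(\bar w\, \partial_k w) = \partial_k |w|^2$, tested with $x_k\psi$.\<close>

lemma product_rule_norm_square:
  fixes \<psi> :: "real^'n \<Rightarrow> real"
  assumes \<psi>: "test_fun \<psi>"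
  shows "2 * (\<integral>x. Re (g x $ k * cnj (w x)) * (x $ k * \<psi> x) \<partial>lebesgue)
    = - (\<integral>x. (cmod (w x))\<^sup>2 * (\<psi> x + x $ k * pd k \<psi> x) \<partial>lebesgue)"
proof -
  let ?\<psi> = "\<lambda>x. x $ k * \<psi> x"
  have t: "test_fun ?\<psi>" by (rule test_fun_mult[OF \<psi> smooth_component])
  have pd: "pd k ?\<psi> x = x $ k * pd k \<psi> x + \<psi> x" for x
    using pd_mult[OF smooth_component test_fun_smooth[OF \<psi>], of k k x] by (simp add: pd_component)
  \<comment> \<open>The definition of the weak derivative is itself a divergence equation, with flux
    w e_k and right-hand side minus the k-th component of \<open>g\<close>. Testing it with the
    conjugate of \<open>w\<close> yields two terms that are complex conjugates of each other, hence
    the factor 2 after taking real parts.\<close>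
  let ?F = "\<lambda>j x. if j = k then w x else 0"
  have F: "loc_L2 (?F j)" for j by (cases "j = k") (simp_all add: w_L2 loc_L2_zero)
  have f: "loc_L2 (\<lambda>x. - 1 * g x $ k)" by (rule loc_L2_cmult[OF g_nth_L2])
  have delta: "(\<Sum>j\<in>UNIV. ?F j x * h j) = w x * h k" for x and h :: "'n \<Rightarrow> complex"
    by (simp add: if_distrib[of "\<lambda>z. z * _"] cong: if_cong)
  have "(\<integral>x. (\<Sum>j\<in>UNIV. ?F j x * (cnj (g x $ j) * complex_of_real (?\<psi> x) + cnj (w x) * complex_of_real (pd j ?\<psi> x))) \<partial>lebesgue)
    = (\<integral>x. (- 1 * g x $ k) * cnj (w x) * complex_of_real (?\<psi> x) \<partial>lebesgue)"
    by (rule weak_form_test_sobolev[OF F g_nth_L2 f w_L2 _ weak_derivative t])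
      (simp_all add: delta weak_derivative)
  then have eq: "(\<integral>x. w x * (cnj (g x $ k) * complex_of_real (?\<psi> x) + cnj (w x) * complex_of_real (pd k ?\<psi> x)) \<partial>lebesgue)
    = - (\<integral>x. g x $ k * cnj (w x) * complex_of_real (?\<psi> x) \<partial>lebesgue)"
    unfolding delta by simp
  have i1: "integrable lebesgue (\<lambda>x. w x * cnj (g x $ k) * complex_of_real (?\<psi> x))"
    by (intro loc_L2_mult_integrable w_L2 loc_L2_cnj g_nth_L2 t)
  have i2: "integrable lebesgue (\<lambda>x. w x * cnj (w x) * complex_of_real (pd k ?\<psi> x))"
    by (intro loc_L2_mult_integrable w_L2 loc_L2_cnj test_fun_pd[OF t])
  have i3: "integrable lebesgue (\<lambda>x. g x $ k * cnj (w x) * complex_of_real (?\<psi> x))"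
    by (intro loc_L2_mult_integrable w_L2 loc_L2_cnj g_nth_L2 t)
  have "(\<integral>x. w x * (cnj (g x $ k) * complex_of_real (?\<psi> x) + cnj (w x) * complex_of_real (pd k ?\<psi> x)) \<partial>lebesgue)
    = (\<integral>x. w x * cnj (g x $ k) * complex_of_real (?\<psi> x) \<partial>lebesgue) + (\<integral>x. w x * cnj (w x) * complex_of_real (pd k ?\<psi> x) \<partial>lebesgue)"
    unfolding Bochner_Integration.integral_add[OF i1 i2, symmetric] by (simp add: algebra_simps)
  then have "Re (\<integral>x. w x * cnj (g x $ k) * complex_of_real (?\<psi> x) \<partial>lebesgue) + Re (\<integral>x. w x * cnj (w x) * complex_of_real (pd k ?\<psi> x) \<partial>lebesgue)
     = - Re (\<integral>x. g x $ k * cnj (w x) * complex_of_real (?\<psi> x) \<partial>lebesgue)"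
    using eq by (metis plus_complex.simps(1) uminus_complex.simps(1))
  moreover have "Re (\<integral>x. w x * cnj (g x $ k) * complex_of_real (?\<psi> x) \<partial>lebesgue) = (\<integral>x. Re (g x $ k * cnj (w x)) * ?\<psi> x \<partial>lebesgue)"
    unfolding integral_Re[OF i1, symmetric] by (intro Bochner_Integration.integral_cong) (auto simp: algebra_simps)
  moreover have "Re (\<integral>x. g x $ k * cnj (w x) * complex_of_real (?\<psi> x) \<partial>lebesgue) = (\<integral>x. Re (g x $ k * cnj (w x)) * ?\<psi> x \<partial>lebesgue)"
    unfolding integral_Re[OF i3, symmetric] by (intro Bochner_Integration.integral_cong) (auto simp: algebra_simps)
  moreover have "Re (\<integral>x. w x * cnj (w x) * complex_of_real (pd k ?\<psi> x) \<partial>lebesgue) = (\<integral>x. (cmod (w x))\<^sup>2 * (\<psi> x + x $ k * pd k \<psi> x) \<partial>lebesgue)"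
    unfolding integral_Re[OF i2, symmetric]
  proof (intro Bochner_Integration.integral_cong refl)
    show "Re (w x * cnj (w x) * complex_of_real (pd k ?\<psi> x)) = (cmod (w x))\<^sup>2 * (\<psi> x + x $ k * pd k \<psi> x)" for x
      unfolding pd by (simp add: complex_mult_cnj cmod_power2 algebra_simps)
  qed
  ultimately show ?thesis by simp
qed

text \<open>By \<open>product_rule_norm_square\<close> the integral in \<open>mono\<close> equals
  \<open>2 * \<mu> * P + 2 * (\<Sum>k\<in>UNIV. q k)\<close>. The real part of the tested right-hand
  side is -1/4 of it, since i |w|^2 is purely imaginary, and is therefore nonpositive.\<close>

lemma energy_inequality:
  fixes \<psi> :: "real^'n \<Rightarrow> real"
  assumes \<psi>: "test_fun \<psi>" and nn: "\<And>x. \<psi> x \<ge> 0"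
  shows "lam * (\<integral>x. (norm (g x))\<^sup>2 * \<psi> x \<partial>lebesgue)
    \<le> (\<integral>x. - Re (\<Sum>k\<in>UNIV. flux k x * cnj (w x) * complex_of_real (pd k \<psi> x)) \<partial>lebesgue)"
proof -
  define P where "P = (\<integral>x. (cmod (w x))\<^sup>2 * \<psi> x \<partial>lebesgue)"
  define q where "q k = (\<integral>x. Re (g x $ k * cnj (w x)) * (x $ k * \<psi> x) \<partial>lebesgue)" for k
  have t: "test_fun (\<lambda>x. x $ k * \<psi> x)" and t': "test_fun (\<lambda>x. x $ k * pd k \<psi> x)" for k
    using test_fun_mult[OF _ smooth_component] \<psi> test_fun_pd[OF \<psi>] by blast+
  have iP: "integrable lebesgue (\<lambda>x. (cmod (w x))\<^sup>2 * \<psi> x)" by (rule integrable_norm_mult[OF \<psi>])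
  have in': "integrable lebesgue (\<lambda>x. (cmod (w x))\<^sup>2 * (\<psi> x + x $ k * pd k \<psi> x))" for k
    unfolding distrib_left by (intro Bochner_Integration.integrable_add integrable_norm_mult(1) \<psi> t')
  have "(\<integral>x. 2 * \<mu> * (cmod (w x))\<^sup>2 * \<psi> x
      - (cmod (w x))\<^sup>2 * (real CARD('n) * \<psi> x + (\<Sum>k\<in>UNIV. x $ k * pd k \<psi> x)) \<partial>lebesgue)
    = (\<integral>x. 2 * \<mu> * ((cmod (w x))\<^sup>2 * \<psi> x) - (\<Sum>k\<in>UNIV. (cmod (w x))\<^sup>2 * (\<psi> x + x $ k * pd k \<psi> x)) \<partial>lebesgue)"
  proof (intro Bochner_Integration.integral_cong refl)
    fix x
    have "(\<Sum>k\<in>UNIV. (cmod (w x))\<^sup>2 * (\<psi> x + x $ k * pd k \<psi> x)) =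
        (cmod (w x))\<^sup>2 * (real CARD('n) * \<psi> x + (\<Sum>k\<in>UNIV. x $ k * pd k \<psi> x))"
      by (simp only: sum_distrib_left[symmetric] sum.distrib) simp
    then show "2 * \<mu> * (cmod (w x))\<^sup>2 * \<psi> x - (cmod (w x))\<^sup>2 * (real CARD('n) * \<psi> x + (\<Sum>k\<in>UNIV. x $ k * pd k \<psi> x)) =
        2 * \<mu> * ((cmod (w x))\<^sup>2 * \<psi> x) - (\<Sum>k\<in>UNIV. (cmod (w x))\<^sup>2 * (\<psi> x + x $ k * pd k \<psi> x))"
      by (simp only: mult.assoc)
  qed
  also have "\<dots> = 2 * \<mu> * P - (\<Sum>k\<in>UNIV. \<integral>x. (cmod (w x))\<^sup>2 * (\<psi> x + x $ k * pd k \<psi> x) \<partial>lebesgue)"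
    using iP in' by (simp add: P_def)
  also have "\<dots> = 2 * \<mu> * P + 2 * (\<Sum>k\<in>UNIV. q k)"
    using product_rule_norm_square[OF \<psi>] by (simp add: q_def sum_distrib_left sum_negf)
  finally have mono_eq: "(\<integral>x. 2 * \<mu> * (cmod (w x))\<^sup>2 * \<psi> x
      - (cmod (w x))\<^sup>2 * (real CARD('n) * \<psi> x + (\<Sum>k\<in>UNIV. x $ k * pd k \<psi> x)) \<partial>lebesgue)
    = 2 * \<mu> * P + 2 * (\<Sum>k\<in>UNIV. q k)" .
  have mono': "2 * \<mu> * P + 2 * (\<Sum>k\<in>UNIV. q k) \<ge> 0"
    unfolding mono_eq[symmetric] using mono \<psi> nn by blast
  have i1: "integrable lebesgue (\<lambda>x. flux k x * cnj (g x $ k) * complex_of_real (\<psi> x))" for k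
    by (intro loc_L2_mult_integrable flux_L2 loc_L2_cnj g_nth_L2 \<psi>)
  have i2: "integrable lebesgue (\<lambda>x. flux k x * cnj (w x) * complex_of_real (pd k \<psi> x))" for k
    by (intro loc_L2_mult_integrable flux_L2 loc_L2_cnj w_L2 test_fun_pd \<psi>)
  have i3: "integrable lebesgue (\<lambda>x. rhs x * cnj (w x) * complex_of_real (\<psi> x))"
    by (intro loc_L2_mult_integrable rhs_L2 loc_L2_cnj w_L2 \<psi>)
  have i4: "integrable lebesgue (\<lambda>x. g x $ k * cnj (w x) * complex_of_real (x $ k * \<psi> x))" for k
    by (intro loc_L2_mult_integrable g_nth_L2 loc_L2_cnj w_L2 t)
  have Re_of_real: "Re (a * complex_of_real r) = Re a * r" for a r by simp
  have iq: "integrable lebesgue (\<lambda>x. Re (g x $ k * cnj (w x)) * (x $ k * \<psi> x))" for k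
    using integrable_Re[OF i4[of k]] unfolding Re_of_real .
  let ?I = "\<lambda>x. \<Sum>k\<in>UNIV. flux k x * cnj (g x $ k) * complex_of_real (\<psi> x)"
  let ?J = "\<lambda>x. \<Sum>k\<in>UNIV. flux k x * cnj (w x) * complex_of_real (pd k \<psi> x)"
  have iI: "integrable lebesgue ?I" and iJ: "integrable lebesgue ?J"
    by (intro Bochner_Integration.integrable_sum i1 i2)+
  have "(\<integral>x. ?I x + ?J x \<partial>lebesgue) = (\<integral>x. rhs x * cnj (w x) * complex_of_real (\<psi> x) \<partial>lebesgue)"
    using weak_form_test_sobolev[OF flux_L2 g_nth_L2 rhs_L2 w_L2 weak_equation weak_derivative \<psi>]
    by (simp add: distrib_left sum.distrib mult.assoc)
  then have "integral\<^sup>L lebesgue ?I + integral\<^sup>L lebesgue ?J = (\<integral>x. rhs x * cnj (w x) * complex_of_real (\<psi> x) \<partial>lebesgue)"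
    unfolding Bochner_Integration.integral_add[OF iI iJ] .
  from arg_cong[OF this, of Re]
  have "Re (\<integral>x. ?I x \<partial>lebesgue) + Re (\<integral>x. ?J x \<partial>lebesgue) = Re (\<integral>x. rhs x * cnj (w x) * complex_of_real (\<psi> x) \<partial>lebesgue)"
    unfolding plus_complex.sel .
  also have "\<dots> = (\<integral>x. - (1/2) * (\<mu> * ((cmod (w x))\<^sup>2 * \<psi> x) + (\<Sum>k\<in>UNIV. Re (g x $ k * cnj (w x)) * (x $ k * \<psi> x))) \<partial>lebesgue)"
    unfolding integral_Re[OF i3, symmetric]
  proof (intro Bochner_Integration.integral_cong refl)
    fix x
    have "rhs x * cnj (w x) * complex_of_real (\<psi> x) = complex_of_real (- (1/2) * \<psi> x) *
        ((\<i> + complex_of_real \<mu>) * complex_of_real ((cmod (w x))\<^sup>2) + (\<Sum>k\<in>UNIV. complex_of_real (x $ k) * (g x $ k * cnj (w x))))"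
      unfolding rhs_def complex_norm_square by (simp add: algebra_simps sum_distrib_left)
    also have "Re \<dots> = - (1/2) * \<psi> x * (\<mu> * (cmod (w x))\<^sup>2 + (\<Sum>k\<in>UNIV. x $ k * Re (g x $ k * cnj (w x))))"
      by (simp only: Re_complex_of_real Im_complex_of_real times_complex.sel plus_complex.sel Re_sum imaginary_unit.sel) simp
    also have "\<dots> = - (1/2) * (\<mu> * ((cmod (w x))\<^sup>2 * \<psi> x) + (\<Sum>k\<in>UNIV. Re (g x $ k * cnj (w x)) * (x $ k * \<psi> x)))"
      by (simp add: algebra_simps sum_distrib_left)
    finally show "Re (rhs x * cnj (w x) * complex_of_real (\<psi> x)) =
      - (1/2) * (\<mu> * ((cmod (w x))\<^sup>2 * \<psi> x) + (\<Sum>k\<in>UNIV. Re (g x $ k * cnj (w x)) * (x $ k * \<psi> x)))" .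
  qed
  also have "\<dots> = - (1/2) * (\<mu> * P + (\<Sum>k\<in>UNIV. q k))"
  proof -
    have "integrable lebesgue (\<lambda>x. \<mu> * ((cmod (w x))\<^sup>2 * \<psi> x))" using iP by simp
    moreover have "integrable lebesgue (\<lambda>x. \<Sum>k\<in>UNIV. Re (g x $ k * cnj (w x)) * (x $ k * \<psi> x))"
      by (intro Bochner_Integration.integrable_sum iq)
    ultimately show ?thesis
      unfolding integral_mult_right_zero P_def q_def
        Bochner_Integration.integral_sum[OF iq, symmetric] by simp
  qed
  also have "\<dots> \<le> 0" using mono' by simp
  finally have le: "Re (\<integral>x. ?I x \<partial>lebesgue) \<le> - Re (\<integral>x. ?J x \<partial>lebesgue)" by simp
  have "lam * (\<integral>x. (norm (g x))\<^sup>2 * \<psi> x \<partial>lebesgue) = (\<integral>x. lam * ((norm (g x))\<^sup>2 * \<psi> x) \<partial>lebesgue)"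
    by simp
  also have "\<dots> \<le> (\<integral>x. Re (?I x) \<partial>lebesgue)"
  proof (rule integral_mono)
    show "integrable lebesgue (\<lambda>x. lam * ((norm (g x))\<^sup>2 * \<psi> x))"
      by (intro integrable_mult_right integrable_norm_mult(2) \<psi>)
    show "integrable lebesgue (\<lambda>x. Re (?I x))" using iI by (rule integrable_Re)
    fix x
    \<comment> \<open>The ellipticity hypothesis conjugates the factor with the second index of
      \<open>A\<close>, whereas \<open>flux\<close> contracts that index with \<open>g\<close>
      itself. Hence it is applied to the conjugate vector.\<close>
    have "lam * (norm (g x))\<^sup>2 \<le> Re (\<Sum>k\<in>UNIV. \<Sum>l\<in>UNIV. A x $ k $ l * cnj (g x $ k) * g x $ l)"
      using ellip[rule_format, of "\<chi> k. cnj (g x $ k)" x] by (simp add: norm_cnj_vec)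
    also have "\<dots> = Re (\<Sum>k\<in>UNIV. flux k x * cnj (g x $ k))"
      by (simp add: flux_def sum_distrib_right sum_distrib_left mult_ac)
    finally have "lam * (norm (g x))\<^sup>2 * \<psi> x \<le> Re (\<Sum>k\<in>UNIV. flux k x * cnj (g x $ k)) * \<psi> x"
      using nn by (intro mult_right_mono) auto
    also have "\<dots> = Re (?I x)"
      by (simp add: sum_distrib_right[symmetric])
    finally show "lam * ((norm (g x))\<^sup>2 * \<psi> x) \<le> Re (?I x)" by (simp add: mult.assoc)
  qed
  also have "\<dots> = Re (\<integral>x. ?I x \<partial>lebesgue)" using iI by (rule integral_Re)
  also have "\<dots> \<le> - Re (\<integral>x. ?J x \<partial>lebesgue)" by (rule le)
  also have "\<dots> = (\<integral>x. - Re (?J x) \<partial>lebesgue)" using integral_Re[OF iJ] by simp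
  finally show ?thesis .
qed

text \<open>Differentiating \<eta>^2 leaves one factor \<eta>, so the gradient term on the right
  carries the same weight \<eta>^2 as the left side and can be absorbed. \<open>S\<close> is any
  compact set outside which \<eta> has zero derivatives; it will be an annulus.\<close>

lemma caccioppoli:
  fixes \<eta> :: "real^'n \<Rightarrow> real" and S :: "(real^'n) set"
  assumes \<eta>: "test_fun \<eta>" and S: "compact S" and supp: "\<And>k x. x \<notin> S \<Longrightarrow> pd k \<eta> x = 0"
    and D: "\<And>x. (\<Sum>k\<in>UNIV. \<bar>pd k \<eta> x\<bar>) \<le> D" and "t > 0"
  shows "lam * (\<integral>x. (norm (g x))\<^sup>2 * (\<eta> x)\<^sup>2 \<partial>lebesgue)
    \<le> Lam * (t * (\<integral>x. indicator S x * ((norm (g x))\<^sup>2 * (\<eta> x)\<^sup>2) \<partial>lebesgue)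
        + D\<^sup>2 / t * (\<integral>x. indicator S x * (cmod (w x))\<^sup>2 \<partial>lebesgue))"
proof -
  let ?\<psi> = "\<lambda>x. \<eta> x * \<eta> x"
  have \<psi>: "test_fun ?\<psi>" by (rule test_fun_square[OF \<eta>])
  have pd: "pd k ?\<psi> x = 2 * \<eta> x * pd k \<eta> x" for k x
    using pd_mult[OF test_fun_smooth[OF \<eta>] test_fun_smooth[OF \<eta>], of k x] by simp
  have Sm: "S \<in> sets lebesgue" using S by (simp add: borel_compact)
  have ig: "integrable lebesgue (\<lambda>x. indicat_real S x * ((norm (g x))\<^sup>2 * (\<eta> x)\<^sup>2))"
    using integrable_mult_indicator[OF Sm integrable_norm_mult(2)[OF \<psi>]] by (simp add: power2_eq_square)
  have iw: "integrable lebesgue (\<lambda>x. indicat_real S x * (cmod (w x))\<^sup>2)"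
    by (rule loc_L2_integrable[OF w_L2 S])
  have "lam * (\<integral>x. (norm (g x))\<^sup>2 * (\<eta> x)\<^sup>2 \<partial>lebesgue)
      \<le> (\<integral>x. - Re (\<Sum>k\<in>UNIV. flux k x * cnj (w x) * complex_of_real (pd k ?\<psi> x)) \<partial>lebesgue)"
    using energy_inequality[OF \<psi>] by (simp add: power2_eq_square)
  also have "\<dots> \<le> (\<integral>x. Lam * (t * (indicat_real S x * ((norm (g x))\<^sup>2 * (\<eta> x)\<^sup>2))
      + D\<^sup>2 / t * (indicat_real S x * (cmod (w x))\<^sup>2)) \<partial>lebesgue)"
  proof (rule integral_mono_AE')
    show "integrable lebesgue (\<lambda>x. Lam * (t * (indicat_real S x * ((norm (g x))\<^sup>2 * (\<eta> x)\<^sup>2))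
      + D\<^sup>2 / t * (indicat_real S x * (cmod (w x))\<^sup>2)))"
      by (intro integrable_mult_right Bochner_Integration.integrable_add ig iw)
    show "AE x in lebesgue. - Re (\<Sum>k\<in>UNIV. flux k x * cnj (w x) * complex_of_real (pd k ?\<psi> x))
      \<le> Lam * (t * (indicat_real S x * ((norm (g x))\<^sup>2 * (\<eta> x)\<^sup>2)) + D\<^sup>2 / t * (indicat_real S x * (cmod (w x))\<^sup>2))"
    proof (rule AE_I2)
      fix x
      show "- Re (\<Sum>k\<in>UNIV. flux k x * cnj (w x) * complex_of_real (pd k ?\<psi> x))
        \<le> Lam * (t * (indicat_real S x * ((norm (g x))\<^sup>2 * (\<eta> x)\<^sup>2)) + D\<^sup>2 / t * (indicat_real S x * (cmod (w x))\<^sup>2))"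
      proof (cases "x \<in> S")
        case True
        let ?a = "norm (g x) * \<bar>\<eta> x\<bar>" and ?b = "D * cmod (w x)"
        have "- Re (\<Sum>k\<in>UNIV. flux k x * cnj (w x) * complex_of_real (pd k ?\<psi> x))
            \<le> cmod (\<Sum>k\<in>UNIV. flux k x * cnj (w x) * complex_of_real (pd k ?\<psi> x))"
          using abs_Re_le_cmod by (meson abs_le_D2)
        also have "\<dots> \<le> (\<Sum>k\<in>UNIV. cmod (flux k x * cnj (w x) * complex_of_real (pd k ?\<psi> x)))"
          by (rule norm_sum)
        also have "\<dots> \<le> (\<Sum>k\<in>UNIV. (Lam * norm (g x)) * (cmod (w x) * (2 * \<bar>\<eta> x\<bar> * \<bar>pd k \<eta> x\<bar>)))"
        proof (rule sum_mono)
          fix k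
          have "cmod (flux k x * cnj (w x) * complex_of_real (pd k ?\<psi> x)) = cmod (flux k x) * (cmod (w x) * (2 * \<bar>\<eta> x\<bar> * \<bar>pd k \<eta> x\<bar>))"
            unfolding pd norm_mult norm_of_real by (simp add: abs_mult mult.assoc)
          also have "\<dots> \<le> (Lam * norm (g x)) * (cmod (w x) * (2 * \<bar>\<eta> x\<bar> * \<bar>pd k \<eta> x\<bar>))"
            by (intro mult_right_mono flux_le) auto
          finally show "cmod (flux k x * cnj (w x) * complex_of_real (pd k ?\<psi> x))
            \<le> (Lam * norm (g x)) * (cmod (w x) * (2 * \<bar>\<eta> x\<bar> * \<bar>pd k \<eta> x\<bar>))" .
        qed
        also have "\<dots> = (Lam * norm (g x)) * (cmod (w x) * (2 * \<bar>\<eta> x\<bar>)) * (\<Sum>k\<in>UNIV. \<bar>pd k \<eta> x\<bar>)"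
          by (simp add: sum_distrib_left mult_ac)
        also have "\<dots> \<le> (Lam * norm (g x)) * (cmod (w x) * (2 * \<bar>\<eta> x\<bar>)) * D"
          using Lam_pos by (intro mult_left_mono D) auto
        also have "\<dots> = Lam * (2 * (?a * ?b))" by (simp add: mult_ac)
        \<comment> \<open>Young's inequality 2ab \<le> t a^2 + b^2 / t, from splitting the product
          with the square root of t.\<close>
        also have "\<dots> \<le> Lam * (t * ?a\<^sup>2 + ?b\<^sup>2 / t)"
        proof -
          have "?a * ?b = (sqrt t * ?a) * (?b / sqrt t)" using \<open>t > 0\<close> by simp
          also have "\<dots> \<le> ((sqrt t * ?a)\<^sup>2 + (?b / sqrt t)\<^sup>2) / 2" by (rule mult_le_half_squares)
          also have "\<dots> = (t * ?a\<^sup>2 + ?b\<^sup>2 / t) / 2"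
            using \<open>t > 0\<close> by (simp add: power_mult_distrib power_divide)
          finally show ?thesis using Lam_pos by (intro mult_left_mono) auto
        qed
        finally show ?thesis using True by (simp add: power_mult_distrib)
      qed (simp add: pd supp)
    qed
    show "AE x in lebesgue. 0 \<le> Lam * (t * (indicat_real S x * ((norm (g x))\<^sup>2 * (\<eta> x)\<^sup>2)) + D\<^sup>2 / t * (indicat_real S x * (cmod (w x))\<^sup>2))"
      using Lam_pos \<open>t > 0\<close> by simp
  qed
  also have "\<dots> = Lam * (t * (\<integral>x. indicator S x * ((norm (g x))\<^sup>2 * (\<eta> x)\<^sup>2) \<partial>lebesgue)
        + D\<^sup>2 / t * (\<integral>x. indicator S x * (cmod (w x))\<^sup>2 \<partial>lebesgue))"
    using ig iw by simp
  finally show ?thesis .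
qed

end

section \<open>Vanishing of the profile\<close>

text \<open>Rescaling one fixed cutoff by 1/R multiplies its derivatives by 1/R, so
  \<open>D\<close>, a sum of bounds for the original derivatives, is independent of
  \<open>R\<close>. The sum of absolute values is the form in which the derivatives enter
  \<open>caccioppoli\<close>.\<close>

lemma exists_scaled_cutoff:
  "\<exists>D\<ge>0. \<forall>R>0. \<exists>\<eta> :: real^'n::finite \<Rightarrow> real. test_fun \<eta> \<and> (\<forall>x. 0 \<le> \<eta> x \<and> \<eta> x \<le> 1) \<and>
    (\<forall>x. norm x \<le> R \<longrightarrow> \<eta> x = 1) \<and> (\<forall>k x. x \<notin> cball 0 (2 * R) - ball 0 R \<longrightarrow> pd k \<eta> x = 0) \<and>
    (\<forall>x. (\<Sum>k\<in>UNIV. \<bar>pd k \<eta> x\<bar>) \<le> D / R)"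
proof -
  obtain \<eta> :: "real^'n \<Rightarrow> real" where sm: "smooth \<eta>" and \<eta>: "\<And>x. 0 \<le> \<eta> x" "\<And>x. \<eta> x \<le> 1"
    "\<And>x. norm x \<le> 1 \<Longrightarrow> \<eta> x = 1" "\<And>x. norm x \<ge> 2 \<Longrightarrow> \<eta> x = 0"
    using exists_cutoff by blast
  have t: "test_fun \<eta>" by (rule test_funI[OF sm, of 2]) (simp add: \<eta>)
  have "\<exists>B. \<forall>k. \<forall>x. \<bar>pd k \<eta> x\<bar> \<le> B k"
    by (rule choice) (metis test_fun_bounded[OF test_fun_pd[OF t]] real_norm_def)
  then obtain B where B: "\<And>k x. \<bar>pd k \<eta> x\<bar> \<le> B k" by blast
  have B0: "B k \<ge> 0" for k using B[of k 0] by linarith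
  show ?thesis
  proof (intro exI[of _ "\<Sum>k\<in>UNIV. B k"] conjI allI impI)
    show "0 \<le> (\<Sum>k\<in>UNIV. B k)" by (simp add: sum_nonneg B0)
    fix R :: real assume R: "R > 0"
    let ?\<eta> = "\<lambda>x. \<eta> (0 + (1 / R) *\<^sub>R x)"
    have 1: "?\<eta> x = 1" if "norm x \<le> R" for x using that R by (intro \<eta>(3)) (simp add: field_simps)
    have 0: "?\<eta> x = 0" if "norm x > 2 * R" for x using that R by (intro \<eta>(4)) (simp add: field_simps)
    have "pd k ?\<eta> x = 0" if "x \<notin> cball 0 (2 * R) - ball 0 R" for k x
    proof (cases "norm x < R")
      case True
      then show ?thesis using 1 by (intro pd_eq_0_open[of "ball 0 R" x _ 1]) auto
    next
      case False
      then show ?thesis using that 0 by (intro pd_eq_0_outside[of "2 * R"]) auto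
    qed
    moreover have "(\<Sum>k\<in>UNIV. \<bar>pd k ?\<eta> x\<bar>) \<le> (\<Sum>k\<in>UNIV. B k) / R" for x
      unfolding pd_affine[OF sm] sum_divide_distrib
      using B R by (intro sum_mono) (simp add: abs_mult divide_right_mono)
    moreover have "test_fun ?\<eta>" by (rule test_fun_affine[OF t]) (use R in simp)
    ultimately show "\<exists>\<eta> :: real^'n \<Rightarrow> real. test_fun \<eta> \<and> (\<forall>x. 0 \<le> \<eta> x \<and> \<eta> x \<le> 1) \<and>
      (\<forall>x. norm x \<le> R \<longrightarrow> \<eta> x = 1) \<and> (\<forall>k x. x \<notin> cball 0 (2 * R) - ball 0 R \<longrightarrow> pd k \<eta> x = 0) \<and>
      (\<forall>x. (\<Sum>k\<in>UNIV. \<bar>pd k \<eta> x\<bar>) \<le> (\<Sum>k\<in>UNIV. B k) / R)"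
      using 1 \<eta>(1,2) by (intro exI[of _ ?\<eta>]) auto
  qed
qed

text \<open>Compare r with 2R for a nonnegative exponent and with R for a negative one; the absolute
  value in the constant covers both.\<close>

lemma powr_annulus_le:
  fixes r R \<nu> :: real
  assumes "R > 0" "R \<le> r" "r \<le> 2 * R"
  shows "r powr \<nu> \<le> 2 powr \<bar>\<nu>\<bar> * R powr \<nu>"
proof (cases "\<nu> \<ge> 0")
  case True
  have "r powr \<nu> \<le> (2 * R) powr \<nu>" using assms True by (intro powr_mono2) auto
  then show ?thesis using assms True by (simp add: powr_mult)
next
  case False
  have "r powr \<nu> \<le> R powr \<nu>" using assms False by (intro powr_mono2') auto
  also have "\<dots> \<le> 2 powr \<bar>\<nu>\<bar> * R powr \<nu>" 
    using mult_right_mono[OF ge_one_powr_ge_zero[of 2 "\<bar>\<nu>\<bar>"], of "R powr \<nu>"] by simp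
  finally show ?thesis .
qed

text \<open>The annulus has volume of order R^n and |w|^2 is of order R^(-2\<mu>) there, so the mass
  is of order R^(n - 2\<mu>). For R \<ge> 1 this is at most of order R^2 exactly because n - 2\<mu>
  \<le> 2.\<close>

lemma annulus_mass_le:
  fixes w :: "real^'n::finite \<Rightarrow> complex"
  assumes mu: "2 * \<mu> \<ge> real CARD('n) - 2"
    and decay: "\<exists>C R. R > 0 \<and> (AE x in lebesgue. norm x \<ge> R \<longrightarrow> cmod (w x) \<le> C * norm x powr (- \<mu>))"
  shows "\<exists>M R1. M \<ge> 0 \<and> R1 \<ge> 1 \<and>
    (\<forall>R\<ge>R1. (\<integral>x. indicator (cball 0 (2 * R) - ball 0 R) x * (cmod (w x))\<^sup>2 \<partial>lebesgue) \<le> M * R\<^sup>2)"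
proof -
  obtain C R0 where R0: "R0 > 0" and C: "AE x in lebesgue. norm x \<ge> R0 \<longrightarrow> cmod (w x) \<le> C * norm x powr (- \<mu>)"
    using decay by blast
  define E where "E = \<bar>C\<bar> * 2 powr \<bar>\<mu>\<bar>"
  define V where "V = measure lborel (ball (0::real^'n) 1)"
  have "E \<ge> 0" "V \<ge> 0" by (simp_all add: E_def V_def)
  show ?thesis
  proof (rule exI[of _ "E\<^sup>2 * (2 ^ CARD('n) * V)"], rule exI[of _ "max 1 R0"], intro conjI allI impI)
    show "0 \<le> E\<^sup>2 * (2 ^ CARD('n) * V)" using \<open>V \<ge> 0\<close> by simp
    show "1 \<le> max 1 R0" by simp
    fix R assume "max 1 R0 \<le> R"
    then have R: "R \<ge> 1" "R \<ge> R0" by auto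
    let ?S = "cball 0 (2 * R) - ball 0 R :: (real^'n) set"
    have icb: "integrable lebesgue (indicat_real (cball (0::real^'n) (2 * R)))"
      using emeasure_lborel_cball_finite[of "0::real^'n" "2 * R"] by (simp add: integrable_indicator_iff)
    have "(\<integral>x. indicat_real ?S x * (cmod (w x))\<^sup>2 \<partial>lebesgue) \<le> (\<integral>x. (E * R powr (- \<mu>))\<^sup>2 * indicat_real (cball (0::real^'n) (2 * R)) x \<partial>lebesgue)"
    proof (rule integral_mono_AE')
      show "integrable lebesgue (\<lambda>x. (E * R powr (- \<mu>))\<^sup>2 * indicat_real (cball (0::real^'n) (2 * R)) x)"
        using icb by (intro integrable_mult_right)
      show "AE x in lebesgue. indicat_real ?S x * (cmod (w x))\<^sup>2 \<le> (E * R powr (- \<mu>))\<^sup>2 * indicat_real (cball 0 (2 * R)) x"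
        using C
      proof eventually_elim
        case (elim x)
        show ?case
        proof (cases "x \<in> ?S")
          case True
          then have x: "R \<le> norm x" "norm x \<le> 2 * R" by auto
          have "cmod (w x) \<le> C * norm x powr (- \<mu>)" using elim x R by auto
          also have "\<dots> \<le> \<bar>C\<bar> * (2 powr \<bar>- \<mu>\<bar> * R powr (- \<mu>))"
            using x R by (intro mult_mono powr_annulus_le) auto
          finally have "cmod (w x) \<le> E * R powr (- \<mu>)" by (simp add: E_def mult.assoc)
          then have "(cmod (w x))\<^sup>2 \<le> (E * R powr (- \<mu>))\<^sup>2" by (intro power_mono) auto
          then show ?thesis using True by (simp add: indicator_def)
        next
          case False
          then show ?thesis by (auto simp: indicator_def)
        qed
      qed
    qed simp
    also have "\<dots> = (E * R powr (- \<mu>))\<^sup>2 * measure lborel (cball (0::real^'n) (2 * R))"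
      by simp
    also have "measure lborel (cball (0::real^'n) (2 * R)) = (2 * R) ^ CARD('n) * V"
      using content_ball_conv_unit_ball[of "2 * R" "0::real^'n"] R by (simp add: content_cball_conv_ball V_def)
    also have "(E * R powr (- \<mu>))\<^sup>2 * ((2 * R) ^ CARD('n) * V) = E\<^sup>2 * (2 ^ CARD('n) * V) * ((R powr (- \<mu>))\<^sup>2 * R ^ CARD('n))"
      by (simp add: power_mult_distrib mult_ac)
    also have "(R powr (- \<mu>))\<^sup>2 * R ^ CARD('n) = R powr (real CARD('n) - 2 * \<mu>)"
    proof -
      have "(R powr (- \<mu>))\<^sup>2 = R powr (- \<mu> * 2)" using R by (simp add: powr_power mult.commute)
      moreover have "R ^ CARD('n) = R powr real CARD('n)" using R by (simp add: powr_realpow)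
      ultimately have "(R powr (- \<mu>))\<^sup>2 * R ^ CARD('n) = R powr (- \<mu> * 2 + real CARD('n))"
        by (simp only: powr_add)
      then show ?thesis by (simp add: algebra_simps)
    qed
    also have "E\<^sup>2 * (2 ^ CARD('n) * V) * R powr (real CARD('n) - 2 * \<mu>) \<le> E\<^sup>2 * (2 ^ CARD('n) * V) * R powr 2"
      using mu R \<open>V \<ge> 0\<close> by (intro mult_left_mono powr_mono) auto
    also have "R powr 2 = R\<^sup>2" using R by simp
    finally show "(\<integral>x. indicat_real ?S x * (cmod (w x))\<^sup>2 \<partial>lebesgue) \<le> E\<^sup>2 * (2 ^ CARD('n) * V) * R\<^sup>2" .
  qed
qed

section \<open>Bounded energy, vanishing gradient and the conclusion\<close>

context self_similar_profile
begin

definition energy :: "real \<Rightarrow> real" where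
  "energy r = (\<integral>x. indicator (ball 0 r) x * (norm (g x))\<^sup>2 \<partial>lebesgue)"

lemma energy_integrable: "integrable lebesgue (\<lambda>x. indicator (ball 0 r) x * (norm (g x))\<^sup>2)"
proof -
  have "integrable lebesgue (\<lambda>x. indicat_real (ball 0 r) x *\<^sub>R (indicator (cball 0 r) x * (norm (g x))\<^sup>2))"
    by (intro integrable_mult_indicator loc_L2_integrable g_L2 compact_cball ball_lebesgue)
  moreover have e: "indicat_real (ball 0 r) x *\<^sub>R (indicator (cball 0 r) x * (norm (g x))\<^sup>2) = indicator (ball 0 r) x * (norm (g x))\<^sup>2" for x
    by (auto simp: indicator_def)
  ultimately show ?thesis unfolding e by blast
qed

lemma energy_mono: "r \<le> s \<Longrightarrow> energy r \<le> energy s"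
  unfolding energy_def by (intro integral_mono energy_integrable) (auto simp: indicator_def)

text \<open>\<open>G\<close> is the energy weighted by \<eta>^2. Bounding the annulus term by
  \<open>G\<close> gives the estimate for absorption; bounding it by a difference of energies gives
  the one that survives the limit. Radius 3R makes the open ball contain the closed ball of radius
  2R that carries the cutoff.\<close>

lemma energy_estimate:
  assumes mass: "\<And>R. R \<ge> R1 \<Longrightarrow> (\<integral>x. indicator (cball 0 (2 * R) - ball 0 R) x * (cmod (w x))\<^sup>2 \<partial>lebesgue) \<le> M * R\<^sup>2"
    and "R1 \<ge> 1"
  shows "\<exists>K\<ge>0. \<forall>R\<ge>R1. \<exists>G. energy R \<le> G \<and>
    (\<forall>t>0. lam * G \<le> Lam * (t * G + K / t)) \<and>
    (\<forall>t>0. lam * G \<le> Lam * (t * (energy (3 * R) - energy R) + K / t))"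
proof -
  obtain D where "D \<ge> 0" and D: "\<And>R. R > 0 \<Longrightarrow> \<exists>\<eta> :: real^'n \<Rightarrow> real. test_fun \<eta> \<and> (\<forall>x. 0 \<le> \<eta> x \<and> \<eta> x \<le> 1) \<and>
    (\<forall>x. norm x \<le> R \<longrightarrow> \<eta> x = 1) \<and> (\<forall>k x. x \<notin> cball 0 (2 * R) - ball 0 R \<longrightarrow> pd k \<eta> x = 0) \<and>
    (\<forall>x. (\<Sum>k\<in>UNIV. \<bar>pd k \<eta> x\<bar>) \<le> D / R)"
    using exists_scaled_cutoff by blast
  have "0 \<le> (\<integral>x. indicator (cball 0 (2 * R1) - ball 0 R1) x * (cmod (w x))\<^sup>2 \<partial>lebesgue)"
    by (rule Bochner_Integration.integral_nonneg) simp
  also have "\<dots> \<le> M * R1\<^sup>2" by (rule mass) simp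
  finally have "M \<ge> 0" using \<open>R1 \<ge> 1\<close> by (simp add: zero_le_mult_iff)
  show ?thesis
  \<comment> \<open>The constant is independent of \<open>R\<close>: the factor R^-2 from the
    squared derivative bound cancels the R^2 of the mass bound.\<close>
  proof (rule exI[of _ "D\<^sup>2 * M"], intro conjI allI impI)
    show "0 \<le> D\<^sup>2 * M" using \<open>M \<ge> 0\<close> by simp
    fix R assume "R1 \<le> R"
    then have "R > 0" using \<open>R1 \<ge> 1\<close> by simp
    then obtain \<eta> :: "real^'n \<Rightarrow> real" where \<eta>: "test_fun \<eta>" "\<And>x. 0 \<le> \<eta> x" "\<And>x. \<eta> x \<le> 1"
      "\<And>x. norm x \<le> R \<Longrightarrow> \<eta> x = 1" "\<And>k x. x \<notin> cball 0 (2 * R) - ball 0 R \<Longrightarrow> pd k \<eta> x = 0"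
      "\<And>x. (\<Sum>k\<in>UNIV. \<bar>pd k \<eta> x\<bar>) \<le> D / R"
      using D by blast
    let ?S = "cball 0 (2 * R) - ball 0 R :: (real^'n) set"
    have S: "compact ?S" by (intro compact_diff) auto
    define G where "G = (\<integral>x. (norm (g x))\<^sup>2 * (\<eta> x)\<^sup>2 \<partial>lebesgue)"
    define Q where "Q = (\<integral>x. indicator ?S x * ((norm (g x))\<^sup>2 * (\<eta> x)\<^sup>2) \<partial>lebesgue)"
    have iG: "integrable lebesgue (\<lambda>x. (norm (g x))\<^sup>2 * (\<eta> x)\<^sup>2)"
      using integrable_norm_mult(2)[OF test_fun_square[OF \<eta>(1)]] by (simp add: power2_eq_square)
    have \<eta>2: "(\<eta> x)\<^sup>2 \<le> 1" for x using \<eta>(2,3) by (simp add: power_le_one)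
    have Q: "lam * G \<le> Lam * (t * Q + D\<^sup>2 * M / t)" if "t > 0" for t
    proof -
      have "lam * G \<le> Lam * (t * Q + (D / R)\<^sup>2 / t * (\<integral>x. indicator ?S x * (cmod (w x))\<^sup>2 \<partial>lebesgue))"
        unfolding G_def Q_def by (rule caccioppoli[OF \<eta>(1) S \<eta>(5,6) that])
      also have "\<dots> \<le> Lam * (t * Q + (D / R)\<^sup>2 / t * (M * R\<^sup>2))"
        using Lam_pos that by (intro mult_left_mono add_left_mono mass \<open>R1 \<le> R\<close>) auto
      also have "(D / R)\<^sup>2 / t * (M * R\<^sup>2) = D\<^sup>2 * M / t"
        using \<open>R > 0\<close> by (simp add: power_divide)
      finally show ?thesis .
    qed
    have "Q \<le> G"
      unfolding Q_def G_def
      by (rule integral_mono_AE'[OF iG]) (auto simp: indicator_def)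
    moreover have "Q \<le> energy (3 * R) - energy R"
    proof -
      have "Q \<le> (\<integral>x. indicator (ball 0 (3 * R)) x * (norm (g x))\<^sup>2 - indicator (ball 0 R) x * (norm (g x))\<^sup>2 \<partial>lebesgue)"
        unfolding Q_def
      proof (rule integral_mono_AE')
        show "integrable lebesgue (\<lambda>x. indicator (ball 0 (3 * R)) x * (norm (g x))\<^sup>2 - indicator (ball 0 R) x * (norm (g x))\<^sup>2)"
          by (intro Bochner_Integration.integrable_diff energy_integrable)
        show "AE x in lebesgue. indicat_real ?S x * ((norm (g x))\<^sup>2 * (\<eta> x)\<^sup>2)
            \<le> indicator (ball 0 (3 * R)) x * (norm (g x))\<^sup>2 - indicator (ball 0 R) x * (norm (g x))\<^sup>2"
          using \<open>R > 0\<close> \<eta>2 by (intro AE_I2) (auto simp: indicator_def mult_left_le)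
        show "AE x in lebesgue. 0 \<le> indicator (ball 0 (3 * R)) x * (norm (g x))\<^sup>2 - indicator (ball 0 R) x * (norm (g x))\<^sup>2"
          using \<open>R > 0\<close> by (intro AE_I2) (auto simp: indicator_def)
      qed
      also have "\<dots> = energy (3 * R) - energy R"
        unfolding energy_def by (intro Bochner_Integration.integral_diff energy_integrable)
      finally show ?thesis .
    qed
    ultimately have le: "Lam * (t * Q + D\<^sup>2 * M / t) \<le> Lam * (t * G + D\<^sup>2 * M / t)"
      "Lam * (t * Q + D\<^sup>2 * M / t) \<le> Lam * (t * (energy (3 * R) - energy R) + D\<^sup>2 * M / t)" if "t > 0" for t
      using that Lam_pos by (auto intro!: mult_left_mono)
    have "energy R \<le> G"
      unfolding energy_def G_def
      by (intro integral_mono energy_integrable iG) (auto simp: indicator_def \<eta>(4))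
    then show "\<exists>G. energy R \<le> G \<and> (\<forall>t>0. lam * G \<le> Lam * (t * G + D\<^sup>2 * M / t)) \<and>
      (\<forall>t>0. lam * G \<le> Lam * (t * (energy (3 * R) - energy R) + D\<^sup>2 * M / t))"
      using Q le order_trans by (intro exI[of _ G]) blast
  qed
qed

lemma gradient_zero:
  assumes mu: "2 * \<mu> \<ge> real CARD('n) - 2"
    and decay: "\<exists>C R. R > 0 \<and> (AE x in lebesgue. norm x \<ge> R \<longrightarrow> cmod (w x) \<le> C * norm x powr (- \<mu>))"
  shows "AE x in lebesgue. g x = 0"
proof -
  obtain M R1 where "R1 \<ge> 1" and mass: "\<And>R. R \<ge> R1 \<Longrightarrow>
      (\<integral>x. indicator (cball 0 (2 * R) - ball 0 R) x * (cmod (w x))\<^sup>2 \<partial>lebesgue) \<le> M * R\<^sup>2"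
    using annulus_mass_le[OF mu decay] by blast
  obtain K where "K \<ge> 0" and K: "\<And>R. R \<ge> R1 \<Longrightarrow> \<exists>G. energy R \<le> G \<and>
    (\<forall>t>0. lam * G \<le> Lam * (t * G + K / t)) \<and>
    (\<forall>t>0. lam * G \<le> Lam * (t * (energy (3 * R) - energy R) + K / t))"
    using energy_estimate[OF mass \<open>R1 \<ge> 1\<close>] by blast
  define B where "B = 4 * Lam\<^sup>2 * K / lam\<^sup>2"
  have bdd: "energy R \<le> B" if "R \<ge> R1" for R
  proof -
    obtain G where "energy R \<le> G" and G: "\<And>t. t > 0 \<Longrightarrow> lam * G \<le> Lam * (t * G + K / t)"
      using K[OF \<open>R \<ge> R1\<close>] by blast
    \<comment> \<open>With t = lam / (2 Lam) the gradient term on the right becomes half of the left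
      side and is absorbed; what remains is \<open>B\<close>.\<close>
    have "lam * G \<le> Lam * (lam / (2 * Lam) * G + K / (lam / (2 * Lam)))"
      using lam_pos Lam_pos by (intro G) simp
    also have "\<dots> = lam * G / 2 + 2 * Lam\<^sup>2 * K / lam"
      using lam_pos Lam_pos by (simp add: field_simps power2_eq_square)
    finally have "G \<le> B" using lam_pos by (simp add: B_def field_simps power2_eq_square)
    then show ?thesis using \<open>energy R \<le> G\<close> by linarith
  qed
  let ?c = "\<lambda>n::nat. energy (real n)"
  have "incseq ?c" by (intro monoI energy_mono) simp
  \<comment> \<open>\<open>bdd\<close> speaks of radii from \<open>R1\<close> on; monotonicity
    extends it to the smaller ones.\<close>
  moreover have "?c n \<le> B" for n
    using bdd[of "max R1 (real n)"] energy_mono[of "real n" "max R1 (real n)"] by simp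
  ultimately obtain L where L: "?c \<longlonglongrightarrow> L" and le: "\<And>n. ?c n \<le> L"
    using incseq_convergent[of ?c B] by blast
  have L3: "(\<lambda>n. energy (3 * real n)) \<longlonglongrightarrow> L"
    using LIMSEQ_subseq_LIMSEQ[OF L, of "\<lambda>n. 3 * n"] by (simp add: strict_mono_def o_def)
  have key: "lam * L \<le> Lam * (K / t)" if "t > 0" for t
  proof (rule LIMSEQ_le)
    show "(\<lambda>n. lam * ?c n) \<longlonglongrightarrow> lam * L" by (intro tendsto_intros L)
    \<comment> \<open>Both energies tend to the same limit \<open>L\<close>, so the annulus term
      disappears for every fixed \<open>t\<close>.\<close>
    have "(\<lambda>n. Lam * (t * (energy (3 * real n) - ?c n) + K / t)) \<longlonglongrightarrow> Lam * (t * (L - L) + K / t)"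
      by (intro tendsto_intros L L3)
    then show "(\<lambda>n. Lam * (t * (energy (3 * real n) - ?c n) + K / t)) \<longlonglongrightarrow> Lam * (K / t)" by simp
    obtain N :: nat where N: "real N \<ge> R1" using real_arch_simple by blast
    have "lam * ?c n \<le> Lam * (t * (energy (3 * real n) - ?c n) + K / t)" if "n \<ge> N" for n
    proof -
      have "real n \<ge> R1" using that N by linarith
      then obtain G where "energy (real n) \<le> G"
        "lam * G \<le> Lam * (t * (energy (3 * real n) - energy (real n)) + K / t)"
        using K \<open>t > 0\<close> by blast
      then show ?thesis using mult_left_mono[of "energy (real n)" G lam] lam_pos by linarith
    qed
    then show "\<exists>N. \<forall>n\<ge>N. lam * ?c n \<le> Lam * (t * (energy (3 * real n) - ?c n) + K / t)" by blast
  qed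
  have "L \<le> 0"
  proof (rule ccontr)
    assume "\<not> L \<le> 0"
    define p where "p = lam * L"
    \<comment> \<open>Chosen so that p t exceeds Lam K by one, against \<open>key\<close>.\<close>
    define t where "t = (Lam * K + 1) / p"
    have "p > 0" using lam_pos \<open>\<not> L \<le> 0\<close> by (simp add: p_def)
    have "Lam * K + 1 > 0" using Lam_pos \<open>K \<ge> 0\<close> by (simp add: add_nonneg_pos)
    then have "t > 0" using \<open>p > 0\<close> by (simp add: t_def)
    have "p * t \<le> Lam * K" using key[OF \<open>t > 0\<close>, folded p_def] \<open>t > 0\<close> by (simp add: field_simps)
    moreover have "p * t = Lam * K + 1" using \<open>p > 0\<close> by (simp add: t_def)
    ultimately show False by simp
  qed
  have "AE x in lebesgue. indicat_real (ball 0 (real n)) x * (norm (g x))\<^sup>2 = 0" for n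
  proof -
    have "energy (real n) \<ge> 0"
      unfolding energy_def by (rule Bochner_Integration.integral_nonneg) simp
    then have "energy (real n) = 0" using le[of n] \<open>L \<le> 0\<close> by linarith
    then show ?thesis
      using integral_nonneg_eq_0_iff_AE[OF energy_integrable[of "real n"]] by (simp add: energy_def)
  qed
  then have "AE x in lebesgue. \<forall>n. indicat_real (ball 0 (real n)) x * (norm (g x))\<^sup>2 = 0"
    by (simp only: AE_all_countable) blast
  then show ?thesis
  proof eventually_elim
    case (elim x)
    obtain n where "norm x < real n" using reals_Archimedean2 by blast
    then show ?case using elim[rule_format, of n] by simp
  qed
qed

text \<open>With zero gradient the weak equation says that \<open>w\<close> integrates to zero
  against every real test function. Testing this with the conjugate of \<open>w\<close> times a
  cutoff gives zero local L^2 norm.\<close>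

lemma profile_zero:
  assumes g0: "AE x in lebesgue. g x = 0"
  shows "AE x in lebesgue. w x = 0"
proof -
  define c where "c = - (1/2) * (\<i> + complex_of_real \<mu>)"
  \<comment> \<open>The imaginary part of \<open>c\<close> is -1/2 whatever \<mu> is.\<close>
  have "c \<noteq> 0" by (simp add: c_def complex_eq_iff)
  have w\<phi>: "(\<integral>x. w x * complex_of_real (\<phi> x) \<partial>lebesgue) = 0" if \<phi>: "test_fun \<phi>" for \<phi> :: "real^'n \<Rightarrow> real"
  proof -
    note m = borel_measurable_lebesgueI[OF test_fun_measurable[OF \<phi>]]
    have "(\<integral>x. (\<Sum>k\<in>UNIV. flux k x * complex_of_real (pd k \<phi> x)) \<partial>lebesgue) = 0"
      by (rule integral_eq_zero_AE) (use g0 in \<open>eventually_elim, simp add: flux_def\<close>)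
    moreover have "(\<integral>x. rhs x * complex_of_real (\<phi> x) \<partial>lebesgue) = (\<integral>x. c * (w x * complex_of_real (\<phi> x)) \<partial>lebesgue)"
    proof (rule integral_cong_AE)
      show "AE x in lebesgue. rhs x * complex_of_real (\<phi> x) = c * (w x * complex_of_real (\<phi> x))"
        using g0 by eventually_elim (simp add: rhs_def c_def algebra_simps)
    qed (intro complex_measurable_intros borel_measurable_const m loc_L2_measurable[OF rhs_L2] loc_L2_measurable[OF w_L2])+
    ultimately have "c * (\<integral>x. w x * complex_of_real (\<phi> x) \<partial>lebesgue) = 0"
      using weak_equation[OF \<phi>] by simp
    with \<open>c \<noteq> 0\<close> show ?thesis by simp
  qed
  \<comment> \<open>\<open>Suc n\<close> keeps the cutoff radius positive.\<close>
  have ball: "AE x in lebesgue. norm x \<le> real (Suc n) \<longrightarrow> w x = 0" for n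
  proof -
    have "real (Suc n) > 0" by simp
    then obtain \<eta> :: "real^'n \<Rightarrow> real" where \<eta>: "test_fun \<eta>" "\<And>x. 0 \<le> \<eta> x" "\<And>x. norm x \<le> real (Suc n) \<Longrightarrow> \<eta> x = 1"
      using exists_scaled_cutoff by blast
    \<comment> \<open>The vanishing of \<open>w\<close> against test functions is read as a
      divergence equation with flux 0 and right-hand side \<open>w\<close>.\<close>
    have "(\<integral>x. (\<Sum>k\<in>UNIV. 0 * (cnj (g x $ k) * complex_of_real (\<eta> x) + cnj (w x) * complex_of_real (pd k \<eta> x))) \<partial>lebesgue)
      = (\<integral>x. w x * cnj (w x) * complex_of_real (\<eta> x) \<partial>lebesgue)"
      by (rule weak_form_test_sobolev[OF loc_L2_zero g_nth_L2 w_L2 w_L2 _ weak_derivative \<eta>(1)]) (simp_all add: w\<phi>)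
    moreover have "w x * cnj (w x) * complex_of_real (\<eta> x) = complex_of_real ((cmod (w x))\<^sup>2 * \<eta> x)" for x
      unfolding of_real_mult complex_norm_square ..
    ultimately have "(\<integral>x. complex_of_real ((cmod (w x))\<^sup>2 * \<eta> x) \<partial>lebesgue) = 0"
      by (simp only: mult_zero_left sum.neutral_const Bochner_Integration.integral_zero)
    then have "(\<integral>x. (cmod (w x))\<^sup>2 * \<eta> x \<partial>lebesgue) = 0"
      by (simp only: integral_complex_of_real of_real_eq_0_iff)
    then have "AE x in lebesgue. (cmod (w x))\<^sup>2 * \<eta> x = 0"
      using integral_nonneg_eq_0_iff_AE[OF integrable_norm_mult(1)[OF \<eta>(1)]] \<eta>(2) by simp
    then show ?thesis by eventually_elim (use \<eta>(3) in auto)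
  qed
  then have "AE x in lebesgue. \<forall>n. norm x \<le> real (Suc n) \<longrightarrow> w x = 0"
    by (simp only: AE_all_countable) blast
  then show ?thesis
  proof eventually_elim
    case (elim x)
    obtain n where "norm x < real n" using reals_Archimedean2 by blast
    then show ?case using elim[rule_format, of n] by simp
  qed
qed

end

theorem theorem2p4:
  fixes A :: "real^'n::finite \<Rightarrow> complex^'n^'n"
    and w :: "real^'n \<Rightarrow> complex"
    and g :: "real^'n \<Rightarrow> complex^'n"
    and \<mu> lam Lam :: real
  assumes mu: "2 * \<mu> \<ge> real CARD('n) - 2"
    and A_meas: "A \<in> borel_measurable lebesgue"
    and A_bdd: "bounded (range A)"
    and lam_pos: "lam > 0" and Lam_pos: "Lam > 0"
    and ellip: "\<forall>x p. Re (\<Sum>k\<in>UNIV. \<Sum>l\<in>UNIV. A x $ k $ l * p $ k * cnj (p $ l)) \<ge> lam * (norm p)\<^sup>2"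
    and bound: "\<forall>x p. (norm (A x *v p))\<^sup>2 \<le> Lam\<^sup>2 * (norm p)\<^sup>2"
    and H1: "H1_loc w g"
    and eqn: "\<forall>\<phi>::real^'n \<Rightarrow> complex. test_fun \<phi> \<longrightarrow>
       integral\<^sup>L lebesgue (\<lambda>x. \<Sum>k\<in>UNIV. (\<Sum>l\<in>UNIV. A x $ k $ l * g x $ l) * pd k \<phi> x)
       = - integral\<^sup>L lebesgue (\<lambda>x. (1/2) * (\<i> * w x + complex_of_real \<mu> * w x
              + (\<Sum>k\<in>UNIV. complex_of_real (x $ k) * g x $ k)) * \<phi> x)"
    and decay: "\<exists>C R. R > 0 \<and> (AE x in lebesgue. norm x \<ge> R \<longrightarrow> cmod (w x) \<le> C * norm x powr (- \<mu>))"
    and mono: "\<forall>\<phi>::real^'n \<Rightarrow> real. test_fun \<phi> \<and> (\<forall>x. \<phi> x \<ge> 0) \<longrightarrow>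
       integral\<^sup>L lebesgue (\<lambda>x. 2 * \<mu> * (cmod (w x))\<^sup>2 * \<phi> x
          - (cmod (w x))\<^sup>2 * (real CARD('n) * \<phi> x + (\<Sum>k\<in>UNIV. x $ k * pd k \<phi> x))) \<ge> 0"
  shows "AE x in lebesgue. w x = 0"
proof -
  interpret self_similar_profile A w g \<mu> lam Lam
    by unfold_locales (fact A_meas lam_pos Lam_pos ellip bound H1 eqn mono)+
  show ?thesis
    by (rule profile_zero[OF gradient_zero[OF mu decay]])
qed

end
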